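(* Let $n\ge1$, ${\bf x}=(x_1,\dots,x_n)$, $\overline{x}_k=x_k^{-1}$, ${\bf a}=(a_1,a_2,\ldots)$ with the convention $a_m=0$ for $m\le0$, and let $\lambda$ be a partition of length exactly $n$. Let ${\cal T}^{eod}_\lambda$ be the set of $T\in{\cal T}^{eo}_\lambda$ such that $T_{k1}\in\{k,\overline{k}\}$ for all $k=1,\dots,n$, and let ${\rm bar}(T)$ be the number of barred entries in the first column of $T$. Then $$o'_\lambda({\bf x},\overline{{\bf x}}|{\bf a})=\sum_{T\in{\cal T}^{eod}_\lambda}(-1)^{{\rm bar}(T)}\prod_{(i,j)\in F^\lambda}{\rm wgt}(T_{ij}),$$ where an entry $T_{ij}=k$ has weight $x_k+a_{2k-1-n+j-i+\delta_{ik}}$ ($\delta_{ik}=1$ if $i=k$, else $0$) and an entry $T_{ij}=\overline{k}$ has weight $\overline{x}_k+a_{2k-n+j-i}$.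
   Context: For an indeterminate $y$ and integer $m\ge0$, $(y|{\bf a})^m=(y+a_1)\cdots(y+a_m)$ for $m>0$, $(y|{\bf a})^0=1$. The factorial difference character is $o'_\lambda({\bf x},\overline{{\bf x}}|{\bf a})=\left|(x_i|{\bf a})^{\lambda_j+n-j}-(\overline{x}_i|{\bf a})^{\lambda_j+n-j}\right|/\big(\tfrac12\left|(x_i|{\bf a})^{n-j}+(\overline{x}_i|{\bf a})^{n-j}\right|\big)$ ($n\times n$ determinants, $(i,j)$ entry shown). $F^\lambda=\{(i,j):1\le i\le\ell(\lambda),1\le j\le\lambda_i\}$. ${\cal T}^{eo}_\lambda$ is the set of fillings $T$ of $F^\lambda$ with entries $T_{ij}$ from $\{1<\overline{1}<2<\overline{2}<\cdots<n<\overline{n}\}$ such that: entries weakly increase along rows and down columns; no two identical entries in any column; neither $k$ nor $\overline{k}$ appears lower than row $k$; and if an entry $k$ appears in row $k$ then any entry $\overline{k}$ in that row has an entry $k$ immediately above it in row $k-1$. *)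

theory Defs
  imports
    "HOL-Library.FuncSet"
    "Jordan_Normal_Form.Determinant"
begin

(* Partitions are weakly decreasing lists of positive integers, so the length of the partition is
   the length of the list.  Parts are indexed from 1, and parts beyond the length are 0. *)

definition is_partition :: "nat list \<Rightarrow> bool" where
  "is_partition lam \<longleftrightarrow> sorted_wrt (\<ge>) lam \<and> (\<forall>p \<in> set lam. 0 < p)"

definition part_at :: "nat list \<Rightarrow> nat \<Rightarrow> nat" where
  "part_at lam i = (if 1 \<le> i \<and> i \<le> length lam then lam ! (i - 1) else 0)"

definition young_diagram :: "nat list \<Rightarrow> (nat \<times> nat) set" where
  "young_diagram lam = {(i, j). 1 \<le> i \<and> i \<le> length lam \<and> 1 \<le> j \<and> j \<le> part_at lam i}"

definition factorial_power :: "(int \<Rightarrow> 'a::comm_ring_1) \<Rightarrow> 'a \<Rightarrow> nat \<Rightarrow> 'a" where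
  "factorial_power a y m = (\<Prod>r = 1..m. y + a (int r))"

(* Matrices are indexed from 0, while x, xb and the parts of lam are indexed from 1; hence the
   shifts by Suc below. *)

definition factorial_difference_character ::
  "nat \<Rightarrow> nat list \<Rightarrow> (nat \<Rightarrow> 'a::field) \<Rightarrow> (nat \<Rightarrow> 'a) \<Rightarrow> (int \<Rightarrow> 'a) \<Rightarrow> 'a" where
  "factorial_difference_character n lam x xb a =
     det (mat n n (\<lambda>(i, j).
         factorial_power a (x (Suc i)) (part_at lam (Suc j) + n - Suc j)
       - factorial_power a (xb (Suc i)) (part_at lam (Suc j) + n - Suc j)))
     / (1 / 2 * det (mat n n (\<lambda>(i, j).
         factorial_power a (x (Suc i)) (n - Suc j)
       + factorial_power a (xb (Suc i)) (n - Suc j))))"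

datatype letter = Unbarred nat | Barred nat

fun letter_rank :: "letter \<Rightarrow> nat" where
  "letter_rank (Unbarred k) = 2 * k"
| "letter_rank (Barred k) = 2 * k + 1"

lemma letter_rank_inject: "letter_rank s = letter_rank t \<Longrightarrow> s = t"
  by (cases s; cases t) (auto, presburger+)

instantiation letter :: linorder
begin

definition less_eq_letter :: "letter \<Rightarrow> letter \<Rightarrow> bool" where
  "s \<le> t \<longleftrightarrow> letter_rank s \<le> letter_rank t"

definition less_letter :: "letter \<Rightarrow> letter \<Rightarrow> bool" where
  "s < t \<longleftrightarrow> letter_rank s < letter_rank t"

instance
  by standard (auto simp: less_eq_letter_def less_letter_def intro: letter_rank_inject)

end

definition alphabet :: "nat \<Rightarrow> letter set" where
  "alphabet n = Unbarred ` {1..n} \<union> Barred ` {1..n}"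

(* Fillings are extensional functions on the diagram, so that distinct members of the set are
   distinct fillings and the set is finite.  In the last condition, for k = 1, the cell (0, j) is
   not in the diagram: an entry Unbarred 1 in row 1 excludes every Barred 1 from that row. *)

definition tableaux_eo :: "nat \<Rightarrow> nat list \<Rightarrow> (nat \<times> nat \<Rightarrow> letter) set" where
  "tableaux_eo n lam = {T \<in> young_diagram lam \<rightarrow>\<^sub>E alphabet n.
     (\<forall>i j j'. (i, j) \<in> young_diagram lam \<and> (i, j') \<in> young_diagram lam \<and> j \<le> j'
        \<longrightarrow> T (i, j) \<le> T (i, j')) \<and>
     (\<forall>i i' j. (i, j) \<in> young_diagram lam \<and> (i', j) \<in> young_diagram lam \<and> i \<le> i'
        \<longrightarrow> T (i, j) \<le> T (i', j)) \<and>
     (\<forall>i i' j. (i, j) \<in> young_diagram lam \<and> (i', j) \<in> young_diagram lam \<and> i \<noteq> i'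
        \<longrightarrow> T (i, j) \<noteq> T (i', j)) \<and>
     (\<forall>i j k. (i, j) \<in> young_diagram lam \<and> T (i, j) \<in> {Unbarred k, Barred k}
        \<longrightarrow> i \<le> k) \<and>
     (\<forall>k. (\<exists>j. (k, j) \<in> young_diagram lam \<and> T (k, j) = Unbarred k)
        \<longrightarrow> (\<forall>j. (k, j) \<in> young_diagram lam \<and> T (k, j) = Barred k
              \<longrightarrow> (k - 1, j) \<in> young_diagram lam \<and> T (k - 1, j) = Unbarred k))}"

definition tableaux_eod :: "nat \<Rightarrow> nat list \<Rightarrow> (nat \<times> nat \<Rightarrow> letter) set" where
  "tableaux_eod n lam =
     {T \<in> tableaux_eo n lam. \<forall>k \<in> {1..n}. T (k, 1) \<in> {Unbarred k, Barred k}}"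

definition bar_count :: "nat list \<Rightarrow> (nat \<times> nat \<Rightarrow> letter) \<Rightarrow> nat" where
  "bar_count lam T = card {i. (i, 1) \<in> young_diagram lam \<and> (\<exists>k. T (i, 1) = Barred k)}"

definition wgt ::
  "nat \<Rightarrow> (nat \<Rightarrow> 'a::field) \<Rightarrow> (nat \<Rightarrow> 'a) \<Rightarrow> (int \<Rightarrow> 'a) \<Rightarrow> nat \<Rightarrow> nat \<Rightarrow> letter \<Rightarrow> 'a" where
  "wgt n x xb a i j t = (case t of
     Unbarred k \<Rightarrow>
       x k + a (2 * int k - 1 - int n + int j - int i + (if i = k then 1 else 0))
   | Barred k \<Rightarrow> xb k + a (2 * int k - int n + int j - int i))"

end

theory Submission
  imports Defs
begin

text \<open>
  Write \<open>p\<^sub>k(x) = (x|a)\<^sup>k - (xb|a)\<^sup>k\<close>, so that the numerator is the alternant with entries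
  \<open>p\<^bsub>lam\<^sub>j + n - j\<^esub>(x\<^sub>i)\<close>.  If columns satisfy \<open>f\<^sub>k = g\<^sub>k + c\<^sub>k f\<^bsub>k-1\<^esub>\<close> with \<open>f\<^sub>0 = 0\<close>, then subtracting
  from each column a multiple of the next one expands the alternant of \<open>f\<close> over interlacing
  sequences into alternants of \<open>g\<close>, i.e. it strips off a horizontal strip.  Doing this with
  \<open>c\<^sub>k = xb\<^sub>n + a\<^sub>k\<close> and then with \<open>c\<^sub>k = x\<^sub>n + a\<^bsub>k-1\<^esub>\<close> removes the letters barred \<open>n\<close> and \<open>n\<close>: what remains
  is \<open>(x\<^sub>i + xb\<^sub>i - x\<^sub>n - xb\<^sub>n)\<close> times \<open>p\<^bsub>k-1\<^esub>(x\<^sub>i)\<close> for the shifted parameters \<open>a\<^bsub>m-1\<^esub>\<close>, which vanishes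
  in the last row unless \<open>k = 1\<close>.  Summing over the part of the strips in row \<open>n\<close> telescopes to a
  multiple of \<open>p\<^sub>M(x\<^sub>n)\<close> with \<open>M = min(lam\<^sub>n, mu\<^bsub>n-1\<^esub>)\<close>, and the two terms of \<open>p\<^sub>M\<close> are exactly the two
  admissible fillings of row \<open>n\<close>, with \<open>M\<close> or with no unbarred entries.  The same two steps evaluate
  the denominator.
\<close>

subsection \<open>Alternants and interlacing sequences\<close>

text \<open>The part after the last one counts as 1, since all shapes keep full length.\<close>

definition next_part :: "nat \<Rightarrow> (nat \<Rightarrow> nat) \<Rightarrow> nat \<Rightarrow> nat" where
  "next_part n lam j = (if j < n then lam (Suc j) else 1)"

text \<open>For a weakly decreasing positive \<open>lam\<close> these are the shapes left after
  removing a horizontal strip without emptying a row. The functions are extensional so that they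
  match the index set in \<open>det_sum_columns\<close>.\<close>

definition interlacing :: "nat \<Rightarrow> (nat \<Rightarrow> nat) \<Rightarrow> (nat \<Rightarrow> nat) set" where
  "interlacing n lam = (\<Pi>\<^sub>E j\<in>{1..n}. {next_part n lam j..lam j})"

text \<open>\<open>f k i\<close> stands for the entry of exponent \<open>k\<close> in row
  \<open>i\<close>; with ordinary powers this would be the numerator in the bialternant formula for
  a Schur function.\<close>

definition alternant :: "nat \<Rightarrow> (nat \<Rightarrow> nat \<Rightarrow> 'a::comm_ring_1) \<Rightarrow> (nat \<Rightarrow> nat) \<Rightarrow> 'a" where
  "alternant n f lam = det (mat n n (\<lambda>(i, j). f (lam (Suc j) + (n - Suc j)) i))"

text \<open>The recurrence is unrolled from \<open>l\<close> down to \<open>m\<close>;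
  \<open>s\<close> leaves room for the column shift \<open>n - j\<close>. The bound
  \<open>m \<le> Suc l\<close> admits the empty sum, where both sides are the same term, and
  \<open>1 \<le> m\<close> keeps \<open>m - 1\<close> from being truncated.\<close>

lemma telescope_recurrence:
  fixes f g :: "nat \<Rightarrow> 'a::comm_ring_1"
  assumes "\<And>k. f (Suc k) = g (Suc k) + c (Suc k) * f k" and "1 \<le> m" and "m \<le> Suc l"
  shows "f (l + s) = (\<Sum>k\<in>{m..l}. (\<Prod>r\<in>{k<..l}. c (r + s)) * g (k + s))
    + (\<Prod>r\<in>{m..l}. c (r + s)) * f (m - 1 + s)"
  using assms(3)
proof (induction l)
  case 0
  with assms(2) have "m = 1" by simp
  then show ?case by simp
next
  case (Suc l)
  show ?case
  proof (cases "m = Suc (Suc l)")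
    case True
    then show ?thesis by simp
  next
    case False
    with Suc have m: "m \<le> Suc l" and IH: "f (l + s) = (\<Sum>k\<in>{m..l}. (\<Prod>r\<in>{k<..l}. c (r + s)) * g (k + s))
      + (\<Prod>r\<in>{m..l}. c (r + s)) * f (m - 1 + s)" by auto
    have ins: "{k<..Suc l} = insert (Suc l) {k<..l}" if "k \<le> l" for k
      using that by auto
    have "(\<Sum>k\<in>{m..Suc l}. (\<Prod>r\<in>{k<..Suc l}. c (r + s)) * g (k + s)) =
       g (Suc l + s) + (\<Sum>k\<in>{m..l}. (\<Prod>r\<in>{k<..Suc l}. c (r + s)) * g (k + s))"
      using m by (simp add: atLeastAtMostSuc_conv)
    also have "(\<Sum>k\<in>{m..l}. (\<Prod>r\<in>{k<..Suc l}. c (r + s)) * g (k + s)) =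
       c (Suc l + s) * (\<Sum>k\<in>{m..l}. (\<Prod>r\<in>{k<..l}. c (r + s)) * g (k + s))"
      unfolding sum_distrib_left by (rule sum.cong) (auto simp: ins mult_ac)
    finally have 1: "(\<Sum>k\<in>{m..Suc l}. (\<Prod>r\<in>{k<..Suc l}. c (r + s)) * g (k + s)) =
       g (Suc l + s) + c (Suc l + s) * (\<Sum>k\<in>{m..l}. (\<Prod>r\<in>{k<..l}. c (r + s)) * g (k + s))" .
    have 2: "(\<Prod>r\<in>{m..Suc l}. c (r + s)) = c (Suc l + s) * (\<Prod>r\<in>{m..l}. c (r + s))"
      using m by (simp add: atLeastAtMostSuc_conv)
    have "f (Suc l + s) = g (Suc l + s) + c (Suc l + s) * f (l + s)"
      using assms(1)[of "l + s"] by simp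
    then show ?thesis
      unfolding 1 2 IH by (simp add: algebra_simps)
  qed
qed

text \<open>Multilinearity in the columns. In the Leibniz formula the product over columns of sums
  is expanded by \<open>prod_sum_PiE\<close>, so one choice per column becomes an extensional
  function \<open>K\<close>.\<close>

lemma det_sum_columns:
  fixes F :: "nat \<Rightarrow> 'b \<Rightarrow> nat \<Rightarrow> 'a::comm_ring_1"
  assumes "\<And>j. j \<in> {1..n} \<Longrightarrow> finite (S j)"
  shows "det (mat n n (\<lambda>(i, j). \<Sum>k\<in>S (Suc j). w (Suc j) k * F (Suc j) k i)) =
    (\<Sum>K \<in> Pi\<^sub>E {1..n} S. (\<Prod>j\<in>{1..n}. w j (K j)) *
      det (mat n n (\<lambda>(i, j). F (Suc j) (K (Suc j)) i)))"
proof -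
  have shift: "(\<Prod>j<n. h (Suc j)) = (\<Prod>j\<in>{1..n}. h j)" for h :: "nat \<Rightarrow> 'a"
    by (rule prod.reindex_bij_witness[of _ "\<lambda>j. j - 1" Suc]) auto
  let ?P = "{p. p permutes {0..<n}}"
  have "det (mat n n (\<lambda>(i, j). \<Sum>k\<in>S (Suc j). w (Suc j) k * F (Suc j) k i)) =
    (\<Sum>p\<in>?P. signof p * (\<Prod>j<n. \<Sum>k\<in>S (Suc j). w (Suc j) k * F (Suc j) k (p j)))"
    by (subst det_col[of _ n]) (auto intro!: sum.cong prod.cong)
  also have "\<dots> = (\<Sum>p\<in>?P. signof p * (\<Prod>j\<in>{1..n}. \<Sum>k\<in>S j. w j k * F j k (p (j - 1))))"
    by (subst shift[symmetric]) simp
  also have "\<dots> = (\<Sum>p\<in>?P. \<Sum>K\<in>Pi\<^sub>E {1..n} S. signof p *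
      ((\<Prod>j\<in>{1..n}. w j (K j)) * (\<Prod>j\<in>{1..n}. F j (K j) (p (j - 1)))))"
    using assms by (subst prod_sum_PiE) (auto simp: prod.distrib sum_distrib_left)
  also have "\<dots> = (\<Sum>K\<in>Pi\<^sub>E {1..n} S. (\<Prod>j\<in>{1..n}. w j (K j)) *
      (\<Sum>p\<in>?P. signof p * (\<Prod>j\<in>{1..n}. F j (K j) (p (j - 1)))))"
    by (subst sum.swap) (simp add: sum_distrib_left mult_ac)
  also have "\<dots> = (\<Sum>K\<in>Pi\<^sub>E {1..n} S. (\<Prod>j\<in>{1..n}. w j (K j)) *
      det (mat n n (\<lambda>(i, j). F (Suc j) (K (Suc j)) i)))"
    by (subst shift[symmetric], subst det_col[of _ n])
       (auto intro!: sum.cong prod.cong arg_cong2[where f = "(*)"])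
  finally show ?thesis .
qed

lemma det_scale_rows:
  fixes C :: "nat \<Rightarrow> 'a::comm_ring_1"
  shows "det (mat n n (\<lambda>(i, j). C i * M i j)) = (\<Prod>i<n. C i) * det (mat n n (\<lambda>(i, j). M i j))"
  by (subst (1 2) det_def'[of _ n])
     (auto simp: sum_distrib_left prod.distrib mult_ac lessThan_atLeast0 intro!: sum.cong)

text \<open>All columns change at once: subtracting from each a multiple of the original next one is
  right multiplication by a unit lower bidiagonal matrix, whose determinant is 1.\<close>

lemma det_subtract_next_column:
  fixes F :: "nat \<Rightarrow> nat \<Rightarrow> 'a::comm_ring_1"
  shows "det (mat n n (\<lambda>(i, j). F i j - (if Suc j < n then C j * F i (Suc j) else 0))) =
    det (mat n n (\<lambda>(i, j). F i j))"
proof -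
  define U where "U = mat n n (\<lambda>(k, j). if k = j then 1 else if k = Suc j then - C j else 0)"
  have U: "U \<in> carrier_mat n n" by (simp add: U_def)
  have "det U = prod_list (diag_mat U)"
    by (rule det_lower_triangular[OF _ U]) (auto simp: U_def)
  also have "\<dots> = 1"
    unfolding prod_list_diag_prod by (rule prod.neutral) (auto simp: U_def)
  finally have detU: "det U = 1" .
  have "mat n n (\<lambda>(i, j). F i j - (if Suc j < n then C j * F i (Suc j) else 0)) =
    mat n n (\<lambda>(i, j). F i j) * U"
  proof (rule eq_matI)
    fix i j assume "i < dim_row (mat n n (\<lambda>(i, j). F i j) * U)"
      and "j < dim_col (mat n n (\<lambda>(i, j). F i j) * U)"
    then have ij: "i < n" "j < n" by (auto simp: U_def)
    have "(mat n n (\<lambda>(i, j). F i j) * U) $$ (i, j) =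
      (\<Sum>k\<in>{0..<n}. F i k * (if k = j then 1 else if k = Suc j then - C j else 0))"
      using ij by (auto simp: U_def scalar_prod_def intro!: sum.cong)
    also have "\<dots> = (\<Sum>k\<in>{0..<n}. (if k = j then F i k else 0)
        + (if k = Suc j then - C j * F i k else 0))"
      by (rule sum.cong) auto
    also have "\<dots> = F i j - (if Suc j < n then C j * F i (Suc j) else 0)"
      using ij by (simp add: sum.distrib)
    finally show "mat n n (\<lambda>(i, j). F i j - (if Suc j < n then C j * F i (Suc j) else 0)) $$ (i, j)
      = (mat n n (\<lambda>(i, j). F i j) * U) $$ (i, j)"
      using ij by simp
  qed (auto simp: U_def)
  then show ?thesis
    using det_mult[of "mat n n (\<lambda>(i, j). F i j)" n U] U detU by simp
qed

text \<open>Column \<open>j\<close> is unrolled only down to \<open>next_part n lam j\<close>. The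
  remainder then has exponent \<open>lam (Suc j) - 1 + (n - j)\<close>, which is the exponent of the
  next column, so the column operation cancels it exactly. In the last column the remainder is
  \<open>f 0\<close>, which vanishes. What is left in every column is a sum, to be expanded
  multilinearly.\<close>

lemma alternant_interlacing:
  fixes f g :: "nat \<Rightarrow> nat \<Rightarrow> 'a::comm_ring_1"
  assumes f0: "\<And>i. i < n \<Longrightarrow> f 0 i = 0"
    and rec: "\<And>k i. i < n \<Longrightarrow> f (Suc k) i = g (Suc k) i + c (Suc k) * f k i"
    and dec: "\<And>j. j \<in> {1..n} \<Longrightarrow> next_part n lam j \<le> Suc (lam j)"
    and pos: "\<And>j. j \<in> {1..n} \<Longrightarrow> 1 \<le> lam j"
  shows "alternant n f lam = (\<Sum>kap\<in>interlacing n lam.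
    (\<Prod>j\<in>{1..n}. \<Prod>r\<in>{kap j<..lam j}. c (r + (n - j))) * alternant n g kap)"
proof -
  define C where "C j = (\<Prod>r\<in>{next_part n lam (Suc j)..lam (Suc j)}. c (r + (n - Suc j)))" for j
  define F where "F i j = f (lam (Suc j) + (n - Suc j)) i" for i j
  let ?S = "\<lambda>j. {next_part n lam j..lam j}"
  have H: "F i j - (if Suc j < n then C j * F i (Suc j) else 0) =
    (\<Sum>k\<in>?S (Suc j). (\<Prod>r\<in>{k<..lam (Suc j)}. c (r + (n - Suc j))) * g (k + (n - Suc j)) i)"
    if "i < n" "j < n" for i j
  proof -
    have pn: "1 \<le> next_part n lam (Suc j)" using pos[of "Suc (Suc j)"] that by (auto simp: next_part_def)
    have "F i j = (\<Sum>k\<in>?S (Suc j). (\<Prod>r\<in>{k<..lam (Suc j)}. c (r + (n - Suc j))) * g (k + (n - Suc j)) i)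
       + C j * f (next_part n lam (Suc j) - 1 + (n - Suc j)) i"
      unfolding F_def C_def
      by (rule telescope_recurrence[of "\<lambda>k. f k i"]) (use that pn rec dec in auto)
    moreover have "f (next_part n lam (Suc j) - 1 + (n - Suc j)) i = (if Suc j < n then F i (Suc j) else 0)"
    proof (cases "Suc j < n")
      case True
      then have "lam (Suc (Suc j)) - 1 + (n - Suc j) = lam (Suc (Suc j)) + (n - Suc (Suc j))"
        using pn by (auto simp: next_part_def)
      with True show ?thesis by (simp add: next_part_def F_def)
    next
      case False
      with that f0 show ?thesis by (simp add: next_part_def)
    qed
    ultimately show ?thesis by simp
  qed
  have "alternant n f lam = det (mat n n (\<lambda>(i, j). F i j))"
    by (simp add: alternant_def F_def)
  also have "\<dots> = det (mat n n (\<lambda>(i, j). F i j - (if Suc j < n then C j * F i (Suc j) else 0)))"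
    by (rule det_subtract_next_column[symmetric])
  also have "\<dots> = det (mat n n (\<lambda>(i, j). \<Sum>k\<in>?S (Suc j).
      (\<Prod>r\<in>{k<..lam (Suc j)}. c (r + (n - Suc j))) * g (k + (n - Suc j)) i))"
    by (rule arg_cong[where f = det], rule cong_mat) (auto simp: H)
  also have "\<dots> = (\<Sum>kap\<in>interlacing n lam.
    (\<Prod>j\<in>{1..n}. \<Prod>r\<in>{kap j<..lam j}. c (r + (n - j))) * alternant n g kap)"
    unfolding interlacing_def alternant_def
    by (rule det_sum_columns[where w = "\<lambda>j k. \<Prod>r\<in>{k<..lam j}. c (r + (n - j))"
          and F = "\<lambda>j k. g (k + (n - j))"]) auto
  finally show ?thesis .
qed

text \<open>In the last row every column but the last has exponent at least 2, since the parts are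
  positive and the shift is at least 1. Hence only the corner entry can survive the Laplace
  expansion, and only if the last part is 1.\<close>

lemma alternant_last_row:
  fixes h f :: "nat \<Rightarrow> nat \<Rightarrow> 'a::comm_ring_1"
  assumes zero: "\<And>k. 2 \<le> k \<Longrightarrow> h k n = 0"
    and rest: "\<And>k i. 1 \<le> k \<Longrightarrow> i < n \<Longrightarrow> h (Suc k) i = C i * f k i"
    and pos: "\<And>j. j \<in> {1..Suc n} \<Longrightarrow> 1 \<le> mu j"
  shows "alternant (Suc n) h mu =
    (if mu (Suc n) = 1 then h 1 n * (\<Prod>i<n. C i) * alternant n f mu else 0)"
proof -
  define A where "A = mat (Suc n) (Suc n) (\<lambda>(i, j). h (mu (Suc j) + (Suc n - Suc j)) i)"
  have A: "A \<in> carrier_mat (Suc n) (Suc n)" by (simp add: A_def)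
  have z: "A $$ (n, j) = 0" if "j < n" for j
    using that pos[of "Suc j"] by (auto simp: A_def intro!: zero)
  have l: "A $$ (n, n) = (if mu (Suc n) = 1 then h 1 n else 0)"
    using zero[of "mu (Suc n)"] pos[of "Suc n"] by (auto simp: A_def)
  have "det A = (\<Sum>j<Suc n. A $$ (n, j) * cofactor A n j)"
    by (rule laplace_expansion_row[OF A]) simp
  also have "\<dots> = A $$ (n, n) * cofactor A n n" by (simp add: z)
  also have "cofactor A n n = det (mat_delete A n n)"
    by (simp add: cofactor_def)
  also have "mat_delete A n n = mat n n (\<lambda>(i, j). C i * f (mu (Suc j) + (n - Suc j)) i)"
  proof (rule eq_matI)
    fix i j assume "i < dim_row (mat n n (\<lambda>(i, j). C i * f (mu (Suc j) + (n - Suc j)) i))"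
      "j < dim_col (mat n n (\<lambda>(i, j). C i * f (mu (Suc j) + (n - Suc j)) i))"
    then have ij: "i < n" "j < n" by auto
    \<comment> \<open>Each remaining exponent exceeds by one the corresponding exponent in the
      smaller alternant; this is the step from \<open>k\<close> to \<open>Suc k\<close> in
      \<open>rest\<close>.\<close>
    moreover have "Suc n - Suc j = Suc (n - Suc j)" using ij by simp
    ultimately show "mat_delete A n n $$ (i, j) = mat n n (\<lambda>(i, j). C i * f (mu (Suc j) + (n - Suc j)) i) $$ (i, j)"
      using rest[of "mu (Suc j) + (n - Suc j)" i] pos[of "Suc j"] by (simp add: mat_delete_def A_def)
  qed (auto simp: mat_delete_def A_def)
  also have "det \<dots> = (\<Prod>i<n. C i) * alternant n f mu"
    unfolding alternant_def by (rule det_scale_rows)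
  finally show ?thesis unfolding l by (simp add: alternant_def A_def mult.assoc)
qed

lemma finite_interlacing [simp]: "finite (interlacing n lam)"
  by (simp add: interlacing_def finite_PiE)

lemma interlacing_pos:
  assumes "\<And>j. j \<in> {1..n} \<Longrightarrow> 1 \<le> lam j" and "kap \<in> interlacing n lam" and "j \<in> {1..n}"
  shows "1 \<le> kap j"
proof -
  have "kap j \<in> {next_part n lam j..lam j}"
    using assms(2,3) unfolding interlacing_def by (rule PiE_mem)
  moreover have "1 \<le> next_part n lam j"
    using assms(1)[of "Suc j"] assms(3) by (auto simp: next_part_def)
  ultimately show ?thesis by simp
qed

text \<open>Removing a horizontal strip leaves a weakly decreasing sequence:
  \<open>kap (Suc j)\<close> is at most \<open>lam (Suc j)\<close>, which is at most
  \<open>kap j\<close>. So the outcome of one expansion can be expanded again.\<close>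

lemma interlacing_next_part:
  assumes "kap \<in> interlacing n lam" and "j \<in> {1..n}"
    and "\<And>j. j \<in> {1..n} \<Longrightarrow> 1 \<le> lam j"
  shows "next_part n kap j \<le> kap j"
proof (cases "j < n")
  case True
  have "kap j \<in> {next_part n lam j..lam j}" "kap (Suc j) \<in> {next_part n lam (Suc j)..lam (Suc j)}"
    using assms(1) True assms(2) unfolding interlacing_def by (auto intro!: PiE_mem[OF assms(1)[unfolded interlacing_def]])
  with True show ?thesis by (auto simp: next_part_def)
next
  case False
  with interlacing_pos[OF assms(3,1,2)] show ?thesis by (simp add: next_part_def)
qed

text \<open>Two expansions in succession: from \<open>f\<close> to \<open>g\<close> the strip
  between \<open>lam\<close> and \<open>kap\<close> is removed with coefficients \<open>b\<close>,
  from \<open>g\<close> to \<open>h\<close> the strip between \<open>kap\<close> and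
  \<open>mu\<close> with coefficients \<open>c\<close>. The last row then forces
  \<open>mu (Suc n) = 1\<close> and leaves an alternant of size \<open>n\<close>. The functions are
  abstract because the numerator and the denominator share this step.\<close>

lemma alternant_branching:
  fixes f g h f' :: "nat \<Rightarrow> nat \<Rightarrow> 'a::comm_ring_1"
  assumes "\<And>i. i \<le> n \<Longrightarrow> f 0 i = 0" and "\<And>i. i \<le> n \<Longrightarrow> g 0 i = 0"
    and "\<And>k i. i \<le> n \<Longrightarrow> f (Suc k) i = g (Suc k) i + b (Suc k) * f k i"
    and "\<And>k i. i \<le> n \<Longrightarrow> g (Suc k) i = h (Suc k) i + c (Suc k) * g k i"
    and "\<And>k. 2 \<le> k \<Longrightarrow> h k n = 0"
    and "\<And>k i. 1 \<le> k \<Longrightarrow> i < n \<Longrightarrow> h (Suc k) i = C i * f' k i"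
    and pos: "\<And>j. j \<in> {1..Suc n} \<Longrightarrow> 1 \<le> lam j"
    and dec: "\<And>j. j \<in> {1..n} \<Longrightarrow> lam (Suc j) \<le> lam j"
  shows "alternant (Suc n) f lam = h 1 n * (\<Prod>i<n. C i) *
    (\<Sum>kap\<in>interlacing (Suc n) lam. \<Sum>mu\<in>{mu \<in> interlacing (Suc n) kap. mu (Suc n) = 1}.
      (\<Prod>j\<in>{1..Suc n}. \<Prod>r\<in>{kap j<..lam j}. b (r + (Suc n - j))) *
      (\<Prod>j\<in>{1..Suc n}. \<Prod>r\<in>{mu j<..kap j}. c (r + (Suc n - j))) * alternant n f' mu)"
proof -
  let ?I = "interlacing (Suc n)"
  let ?B = "\<lambda>kap. \<Prod>j\<in>{1..Suc n}. \<Prod>r\<in>{kap j<..lam j}. b (r + (Suc n - j))"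
  let ?C = "\<lambda>kap mu. \<Prod>j\<in>{1..Suc n}. \<Prod>r\<in>{mu j<..kap j}. c (r + (Suc n - j))"
  have g: "alternant (Suc n) g kap = (\<Sum>mu\<in>{mu \<in> ?I kap. mu (Suc n) = 1}.
      ?C kap mu * (h 1 n * (\<Prod>i<n. C i) * alternant n f' mu))"
    if kap: "kap \<in> ?I lam" for kap
  proof -
    have p: "1 \<le> kap j" if "j \<in> {1..Suc n}" for j
      using interlacing_pos[OF pos kap that] .
    have "alternant (Suc n) g kap = (\<Sum>mu\<in>?I kap. ?C kap mu * alternant (Suc n) h mu)"
    proof (rule alternant_interlacing)
      fix j assume "j \<in> {1..Suc n}"
      from interlacing_next_part[OF kap this pos] show "next_part (Suc n) kap j \<le> Suc (kap j)" by simp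
    qed (use assms p in auto)
    also have "\<dots> = (\<Sum>mu\<in>?I kap. if mu (Suc n) = 1
        then ?C kap mu * (h 1 n * (\<Prod>i<n. C i) * alternant n f' mu) else 0)"
    proof (rule sum.cong[OF refl])
      fix mu assume mu: "mu \<in> ?I kap"
      have "1 \<le> mu j" if "j \<in> {1..Suc n}" for j
        using interlacing_pos[OF p mu that] .
      then have "alternant (Suc n) h mu =
        (if mu (Suc n) = 1 then h 1 n * (\<Prod>i<n. C i) * alternant n f' mu else 0)"
        by (intro alternant_last_row) (use assms in auto)
      then show "?C kap mu * alternant (Suc n) h mu = (if mu (Suc n) = 1
        then ?C kap mu * (h 1 n * (\<Prod>i<n. C i) * alternant n f' mu) else 0)"
        by simp
    qed
    finally show ?thesis by (simp add: sum.If_cases Int_def)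
  qed
  have "alternant (Suc n) f lam = (\<Sum>kap\<in>?I lam. ?B kap * alternant (Suc n) g kap)"
  proof (rule alternant_interlacing)
    fix j assume "j \<in> {1..Suc n}"
    then show "next_part (Suc n) lam j \<le> Suc (lam j)"
      using dec[of j] by (auto simp: next_part_def)
  qed (use assms in auto)
  also have "\<dots> = (\<Sum>kap\<in>?I lam. ?B kap * (\<Sum>mu\<in>{mu \<in> ?I kap. mu (Suc n) = 1}.
      ?C kap mu * (h 1 n * (\<Prod>i<n. C i) * alternant n f' mu)))"
    by (rule sum.cong) (simp_all add: g)
  finally show ?thesis by (simp add: sum_distrib_left mult_ac)
qed

subsection \<open>Branching of the numerator and the denominator\<close>

lemma factorial_power_0 [simp]: "factorial_power a y 0 = 1"
  by (simp add: factorial_power_def)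

lemma factorial_power_Suc: "factorial_power a y (Suc m) = factorial_power a y m * (y + a (int m + 1))"
  by (simp add: factorial_power_def mult.commute add.commute)

text \<open>Since \<open>a 0 = 0\<close>, the first factor for the shifted parameters is
  \<open>y\<close> itself, and the other factors are those of the unshifted power.\<close>

lemma factorial_power_shift:
  assumes "a 0 = 0"
  shows "factorial_power (\<lambda>m. a (m - 1)) y (Suc m) = y * factorial_power a y m"
  by (induction m) (simp_all add: factorial_power_Suc assms ac_simps)

definition difference_power ::
  "(nat \<Rightarrow> 'a::comm_ring_1) \<Rightarrow> (nat \<Rightarrow> 'a) \<Rightarrow> (int \<Rightarrow> 'a) \<Rightarrow> nat \<Rightarrow> nat \<Rightarrow> 'a" where
  "difference_power x xb a k i = factorial_power a (x (Suc i)) k - factorial_power a (xb (Suc i)) k"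

text \<open>The exponents are raised by one so that the sequence starts with 0, and the exponent 0 of the
  denominator is halved; this is the factor 1/2 in the definition of the character.\<close>

definition sum_power ::
  "(nat \<Rightarrow> 'a::comm_ring_1) \<Rightarrow> (nat \<Rightarrow> 'a) \<Rightarrow> (int \<Rightarrow> 'a) \<Rightarrow> nat \<Rightarrow> nat \<Rightarrow> 'a" where
  "sum_power x xb a k i = (if k = 0 then 0 else if k = 1 then 1
     else factorial_power a (x (Suc i)) (k - 1) + factorial_power a (xb (Suc i)) (k - 1))"

text \<open>The largest \<open>kap (Suc n)\<close> that both interlacing conditions allow:
  \<open>lam (Suc n)\<close> bounds it directly, and \<open>mu n\<close> through the lower bound on
  \<open>mu\<close>. For \<open>n = 0\<close> there is no row above, and \<open>mu 0\<close> would
  lie outside the index set.\<close>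

definition last_row_bound :: "nat \<Rightarrow> (nat \<Rightarrow> nat) \<Rightarrow> (nat \<Rightarrow> nat) \<Rightarrow> nat" where
  "last_row_bound n lam mu = (if n = 0 then lam 1 else min (lam (Suc n)) (mu n))"

text \<open>The first \<open>n\<close> entries of a member of
  \<open>interlacing (Suc n) lam\<close>; the entry in row \<open>Suc n\<close> is summed
  separately.\<close>

definition inner_strips :: "nat \<Rightarrow> (nat \<Rightarrow> nat) \<Rightarrow> (nat \<Rightarrow> nat) set" where
  "inner_strips n lam = (\<Pi>\<^sub>E j\<in>{1..n}. {lam (Suc j)..lam j})"

lemma finite_inner_strips [simp]: "finite (inner_strips n lam)"
  by (simp add: inner_strips_def finite_PiE)

text \<open>Apart from its own range, the last entry \<open>k\<close> of \<open>kap\<close> meets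
  the other data only in the condition \<open>k \<le> mu n\<close>. Moving this condition into the
  range of \<open>k\<close> lowers the bound on \<open>mu n\<close> to 1, which is what
  \<open>interlacing n kap\<close> asks.\<close>

lemma sum_interlacing_Suc:
  fixes G :: "(nat \<Rightarrow> nat) \<Rightarrow> (nat \<Rightarrow> nat) \<Rightarrow> 'a::comm_monoid_add"
  shows "(\<Sum>kap\<in>interlacing (Suc n) lam. \<Sum>mu\<in>{mu \<in> interlacing (Suc n) kap. mu (Suc n) = 1}. G kap mu) =
    (\<Sum>kap\<in>inner_strips n lam. \<Sum>mu\<in>interlacing n kap. \<Sum>k\<in>{1..last_row_bound n lam mu}.
      G (kap(Suc n := k)) (mu(Suc n := 1)))"
proof -
  let ?N = "Suc n"
  have ext: "k \<in> {1..?N} \<longleftrightarrow> k = ?N \<or> k \<in> {1..n}" for k by auto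
  have "(\<Sum>(kap, mu)\<in>(SIGMA kap:interlacing ?N lam. {mu \<in> interlacing ?N kap. mu ?N = 1}). G kap mu) =
    (\<Sum>(kap, mu, k)\<in>(SIGMA kap:inner_strips n lam. SIGMA mu:interlacing n kap. {1..last_row_bound n lam mu}).
      G (kap(?N := k)) (mu(?N := 1)))"
  proof (rule sum.reindex_bij_witness[where
        j = "\<lambda>(kap, mu). (restrict kap {1..n}, restrict mu {1..n}, kap ?N)"
        and i = "\<lambda>(kap, mu, k). (kap(?N := k), mu(?N := 1))"], goal_cases)
    case (1 p)
    then show ?case
      by (auto simp: interlacing_def PiE_def extensional_def fun_eq_iff restrict_def)
  next
    case (2 p)
    then obtain kap mu where p: "p = (kap, mu)" and kap: "kap \<in> interlacing ?N lam"
      and mu: "mu \<in> interlacing ?N kap" "mu ?N = 1" by auto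
    have k: "kap j \<in> {next_part ?N lam j..lam j}" if "j \<in> {1..?N}" for j
      using kap that unfolding interlacing_def by (rule PiE_mem)
    have m: "mu j \<in> {next_part ?N kap j..kap j}" if "j \<in> {1..?N}" for j
      using mu(1) that unfolding interlacing_def by (rule PiE_mem)
    have m1: "1 \<le> kap ?N" using k[of ?N] by (simp add: next_part_def)
    have "restrict kap {1..n} \<in> inner_strips n lam"
      unfolding inner_strips_def using k by (force simp: next_part_def)
    moreover have "restrict mu {1..n} \<in> interlacing n (restrict kap {1..n})"
      unfolding interlacing_def
    proof (rule restrict_PiE_iff[THEN iffD2], rule ballI)
      fix j assume j: "j \<in> {1..n}"
      then show "mu j \<in> {next_part n (restrict kap {1..n}) j..restrict kap {1..n} j}"
        using m[of j] m1 by (cases "j < n") (auto simp: next_part_def)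
    qed
    moreover have "kap ?N \<in> {1..last_row_bound n lam (restrict mu {1..n})}"
      using k[of ?N] m[of n] m1 by (auto simp: last_row_bound_def next_part_def)
    ultimately show ?case by (simp add: p)
  next
    case (3 p)
    then show ?case
      by (auto simp: interlacing_def inner_strips_def PiE_def extensional_def fun_eq_iff restrict_def)
  next
    case (4 p)
    then obtain kap mu k where p: "p = (kap, mu, k)" and kap: "kap \<in> inner_strips n lam"
      and mu: "mu \<in> interlacing n kap" and k: "k \<in> {1..last_row_bound n lam mu}" by auto
    have kk: "kap j \<in> {lam (Suc j)..lam j}" if "j \<in> {1..n}" for j
      using kap that unfolding inner_strips_def by (rule PiE_mem)
    have m: "mu j \<in> {next_part n kap j..kap j}" if "j \<in> {1..n}" for j
      using mu that unfolding interlacing_def by (rule PiE_mem)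
    have ekap: "kap j = undefined" if "j \<notin> {1..n}" for j
      using kap that unfolding inner_strips_def by (rule PiE_arb)
    have emu: "mu j = undefined" if "j \<notin> {1..n}" for j
      using mu that unfolding interlacing_def by (rule PiE_arb)
    have "kap(?N := k) \<in> interlacing ?N lam"
      unfolding interlacing_def
    proof (rule PiE_I)
      fix j assume "j \<in> {1..?N}"
      then show "(kap(?N := k)) j \<in> {next_part ?N lam j..lam j}"
        using kk[of j] k by (cases "j = ?N") (auto simp: next_part_def last_row_bound_def split: if_splits)
    qed (use ekap in auto)
    moreover have "mu(?N := 1) \<in> interlacing ?N (kap(?N := k))"
      unfolding interlacing_def
    proof (rule PiE_I)
      fix j assume "j \<in> {1..?N}"
      then show "(mu(?N := 1)) j \<in> {next_part ?N (kap(?N := k)) j..(kap(?N := k)) j}"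
        using m[of j] k by (cases "j = ?N"; cases "j = n")
          (auto simp: next_part_def last_row_bound_def split: if_splits)
    qed (use emu in auto)
    ultimately show ?case by (simp add: p)
  next
    case (5 p)
    then obtain kap mu where p: "p = (kap, mu)" and "kap \<in> interlacing ?N lam"
      and "mu \<in> interlacing ?N kap" "mu ?N = 1" by auto
    then have "(restrict kap {1..n})(?N := kap ?N) = kap" "(restrict mu {1..n})(?N := 1) = mu"
      by (auto simp: interlacing_def PiE_def extensional_def fun_eq_iff restrict_def)
    then show ?case by (simp add: p)
  qed
  then show ?thesis
    by (simp add: sum.Sigma)
qed

text \<open>Let \<open>B k\<close> be the product of \<open>yb + a r\<close> over
  \<open>k < r \<le> l\<close>. Since \<open>y - yb\<close> is the difference of
  \<open>y + a k\<close> and \<open>yb + a k\<close>, the summand for \<open>k\<close> is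
  \<open>factorial_power a y k * B k\<close> minus the same expression for \<open>k - 1\<close>. The
  lower end of the collapsed sum is \<open>B 0\<close>, whose first \<open>M\<close> factors give
  the subtracted term.\<close>

lemma last_row_telescope:
  fixes y yb :: "'a::comm_ring_1"
  assumes "M \<le> l"
  shows "(y - yb) * (\<Sum>k\<in>{1..M}. (\<Prod>r\<in>{k<..l}. yb + a (int r)) * (\<Prod>r\<in>{1<..k}. y + a (int r - 1))) =
    (factorial_power a y M - factorial_power a yb M) * (\<Prod>r\<in>{M<..l}. yb + a (int r))"
  using assms
proof (induction M)
  case (Suc M)
  have fp: "(\<Prod>r\<in>{1<..Suc M}. y + a (int r - 1)) = factorial_power a y M"
    unfolding factorial_power_def
    by (rule prod.reindex_bij_witness[of _ Suc "\<lambda>r. r - 1"]) (auto simp: of_nat_diff)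
  have "{M<..l} = insert (Suc M) {Suc M<..l}" using Suc.prems by auto
  then have B: "(\<Prod>r\<in>{M<..l}. yb + a (int r)) = (yb + a (int M + 1)) * (\<Prod>r\<in>{Suc M<..l}. yb + a (int r))"
    by (simp add: add.commute)
  have IH: "(y - yb) * (\<Sum>k\<in>{1..M}. (\<Prod>r\<in>{k<..l}. yb + a (int r)) * (\<Prod>r\<in>{1<..k}. y + a (int r - 1))) =
    (factorial_power a y M - factorial_power a yb M) * (\<Prod>r\<in>{M<..l}. yb + a (int r))"
    using Suc by simp
  have split: "(\<Sum>k\<in>{1..Suc M}. (\<Prod>r\<in>{k<..l}. yb + a (int r)) * (\<Prod>r\<in>{1<..k}. y + a (int r - 1))) =
     (\<Sum>k\<in>{1..M}. (\<Prod>r\<in>{k<..l}. yb + a (int r)) * (\<Prod>r\<in>{1<..k}. y + a (int r - 1)))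
     + (\<Prod>r\<in>{Suc M<..l}. yb + a (int r)) * (\<Prod>r\<in>{1<..Suc M}. y + a (int r - 1))"
    by simp
  show ?case
    unfolding split distrib_left IH fp B factorial_power_Suc by (simp add: algebra_simps)
qed simp

lemma alternant_cong:
  assumes "\<And>j. j \<in> {1..n} \<Longrightarrow> lam j = mu j"
  shows "alternant n f lam = alternant n f mu"
  unfolding alternant_def by (rule arg_cong[where f = det], rule cong_mat) (use assms in auto)

text \<open>The corner entry \<open>h 1 n = y - yb\<close> of the last row is exactly the factor
  that makes the sum over the last entry of \<open>kap\<close> telescope.\<close>

lemma alternant_difference_branching:
  fixes x xb :: "nat \<Rightarrow> 'a::comm_ring_1"
  assumes inv: "\<And>k. k \<in> {1..Suc n} \<Longrightarrow> x k * xb k = 1" and a0: "a 0 = 0"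
    and pos: "\<And>j. j \<in> {1..Suc n} \<Longrightarrow> 1 \<le> lam j"
    and dec: "\<And>j. j \<in> {1..n} \<Longrightarrow> lam (Suc j) \<le> lam j"
  shows "alternant (Suc n) (difference_power x xb a) lam =
    (\<Prod>i<n. (x (Suc i) + xb (Suc i)) - (x (Suc n) + xb (Suc n))) *
    (\<Sum>kap\<in>inner_strips n lam. \<Sum>mu\<in>interlacing n kap.
      (\<Prod>j\<in>{1..n}. \<Prod>r\<in>{kap j<..lam j}. xb (Suc n) + a (int (r + (Suc n - j)))) *
      (\<Prod>j\<in>{1..n}. \<Prod>r\<in>{mu j<..kap j}. x (Suc n) + a (int (r + (Suc n - j)) - 1)) *
      ((factorial_power a (x (Suc n)) (last_row_bound n lam mu)
        - factorial_power a (xb (Suc n)) (last_row_bound n lam mu)) *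
       (\<Prod>r\<in>{last_row_bound n lam mu<..lam (Suc n)}. xb (Suc n) + a (int r))) *
      alternant n (difference_power x xb (\<lambda>m. a (m - 1))) mu)"
proof -
  let ?N = "Suc n"
  let ?y = "x ?N" and ?yb = "xb ?N"
  let ?b = "\<lambda>r. ?yb + a (int r)" and ?c = "\<lambda>r. ?y + a (int r - 1)"
  let ?p = "difference_power x xb"
  \<comment> \<open>The last factor of the power of exponent \<open>k\<close> is written as
    \<open>x - yb\<close> plus \<open>yb + a k\<close>. The second summand carries the coefficient
    \<open>?b\<close>, and \<open>g\<close> collects the first.\<close>
  define g where "g k i = (if k = 0 then 0 else
     (x (Suc i) - ?yb) * factorial_power a (x (Suc i)) (k - 1)
     - (xb (Suc i) - ?yb) * factorial_power a (xb (Suc i)) (k - 1))" for k i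
  \<comment> \<open>The same splitting with \<open>y\<close> in place of \<open>yb\<close>, where
    the factor now available is the one with parameter \<open>a (k - 1)\<close>. At
    \<open>k = 1\<close> the coefficient meets \<open>g 0 = 0\<close>, so \<open>h 1\<close> has to
    be \<open>g 1\<close>. For larger \<open>k\<close> both products contain a zero factor in row
    \<open>n\<close>.\<close>
  define h where "h k i = (if k = 1 then g 1 i else
     (x (Suc i) - ?yb) * (x (Suc i) - ?y) * factorial_power a (x (Suc i)) (k - 2)
     - (xb (Suc i) - ?yb) * (xb (Suc i) - ?y) * factorial_power a (xb (Suc i)) (k - 2))" for k i
  let ?C = "\<lambda>i. (x (Suc i) + xb (Suc i)) - (?y + ?yb)"
  have yy: "?y * ?yb = 1" "?yb * ?y = 1" using inv[of ?N] by (auto simp: mult.commute)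
  have h1: "h 1 n = ?y - ?yb" by (simp add: h_def g_def)
  \<comment> \<open>Because \<open>?yb * ?y = 1 = u * v\<close>, the constant term of the quadratic
    can be exchanged. The cofactor of \<open>u\<close> is then symmetric in \<open>u\<close> and
    \<open>v\<close>, so \<open>x (Suc i)\<close> and \<open>xb (Suc i)\<close> share it and it can
    leave the row.\<close>
  have quad: "(u - ?yb) * (u - ?y) = u * ((u + v) - (?y + ?yb))" if "u * v = 1" for u v
  proof -
    have "(u - ?yb) * (u - ?y) = u * u - u * ?y - u * ?yb + ?yb * ?y" by (simp add: algebra_simps)
    also have "\<dots> = u * u - u * ?y - u * ?yb + u * v" using that yy by simp
    finally show ?thesis by (simp add: algebra_simps)
  qed
  have "alternant ?N (?p a) lam = h 1 n * (\<Prod>i<n. ?C i) *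
    (\<Sum>kap\<in>interlacing ?N lam. \<Sum>mu\<in>{mu \<in> interlacing ?N kap. mu ?N = 1}.
      (\<Prod>j\<in>{1..?N}. \<Prod>r\<in>{kap j<..lam j}. ?b (r + (?N - j))) *
      (\<Prod>j\<in>{1..?N}. \<Prod>r\<in>{mu j<..kap j}. ?c (r + (?N - j))) * alternant n (?p (\<lambda>m. a (m - 1))) mu)"
  proof (rule alternant_branching[where g = g and h = h and b = ?b and c = ?c])
    fix k i assume "i \<le> n"
    show "?p a (Suc k) i = g (Suc k) i + ?b (Suc k) * ?p a k i"
      by (simp add: difference_power_def g_def factorial_power_Suc algebra_simps)
    show "g (Suc k) i = h (Suc k) i + ?c (Suc k) * g k i"
      by (cases k) (simp_all add: g_def h_def factorial_power_Suc algebra_simps)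
  next
    fix k :: nat assume "2 \<le> k"
    then show "h k n = 0" by (simp add: h_def)
  next
    fix k i :: nat assume k: "1 \<le> k" and i: "i < n"
    then obtain m where m: "k = Suc m" by (cases k) auto
    have xx: "x (Suc i) * xb (Suc i) = 1" "xb (Suc i) * x (Suc i) = 1"
      using inv[of "Suc i"] i by (auto simp: mult.commute)
    show "h (Suc k) i = ?C i * ?p (\<lambda>m. a (m - 1)) k i"
      by (simp add: h_def m difference_power_def factorial_power_shift[where a = a, OF a0] quad[OF xx(1)] quad[OF xx(2)])
        (simp add: algebra_simps)
  qed (use pos dec in \<open>simp_all add: difference_power_def g_def\<close>)
  also have "\<dots> = (\<Prod>i<n. ?C i) * (\<Sum>kap\<in>inner_strips n lam. \<Sum>mu\<in>interlacing n kap.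
      (?y - ?yb) * (\<Sum>k\<in>{1..last_row_bound n lam mu}.
      (\<Prod>j\<in>{1..n}. \<Prod>r\<in>{kap j<..lam j}. ?b (r + (?N - j))) *
      (\<Prod>j\<in>{1..n}. \<Prod>r\<in>{mu j<..kap j}. ?c (r + (?N - j))) *
      ((\<Prod>r\<in>{k<..lam ?N}. ?b r) * (\<Prod>r\<in>{1<..k}. ?c r)) *
      alternant n (?p (\<lambda>m. a (m - 1))) mu))"
    (is "_ = _ * ?R")
  proof -
    have cut: "(\<Prod>j\<in>{1..?N}. q j) = (\<Prod>j\<in>{1..n}. q j) * q ?N" for q :: "nat \<Rightarrow> 'a"
      by simp
    have upd: "(\<Prod>j\<in>{1..n}. \<Prod>r\<in>{A j<..(kap(?N := k)) j}. q j r) = (\<Prod>j\<in>{1..n}. \<Prod>r\<in>{A j<..kap j}. q j r)"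
      "(\<Prod>j\<in>{1..n}. \<Prod>r\<in>{(kap(?N := k)) j<..A j}. q j r) = (\<Prod>j\<in>{1..n}. \<Prod>r\<in>{kap j<..A j}. q j r)"
      for A kap :: "nat \<Rightarrow> nat" and k :: nat and q :: "nat \<Rightarrow> nat \<Rightarrow> 'a"
      by (auto intro!: prod.cong)
    have alt: "alternant n f (mu(?N := 1)) = alternant n f mu" for f :: "nat \<Rightarrow> nat \<Rightarrow> 'a" and mu
      by (rule alternant_cong) auto
    show ?thesis
      unfolding sum_interlacing_Suc cut upd alt h1
      by (simp add: sum_distrib_left mult_ac)
  qed
  also have "?R = (\<Sum>kap\<in>inner_strips n lam. \<Sum>mu\<in>interlacing n kap.
      (\<Prod>j\<in>{1..n}. \<Prod>r\<in>{kap j<..lam j}. ?b (r + (?N - j))) *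
      (\<Prod>j\<in>{1..n}. \<Prod>r\<in>{mu j<..kap j}. ?c (r + (?N - j))) *
      ((factorial_power a ?y (last_row_bound n lam mu)
        - factorial_power a ?yb (last_row_bound n lam mu)) *
       (\<Prod>r\<in>{last_row_bound n lam mu<..lam ?N}. ?b r)) *
      alternant n (?p (\<lambda>m. a (m - 1))) mu)"
  proof (intro sum.cong refl)
    fix kap mu
    have M: "last_row_bound n lam mu \<le> lam ?N" by (auto simp: last_row_bound_def)
    show "(?y - ?yb) * (\<Sum>k\<in>{1..last_row_bound n lam mu}.
      (\<Prod>j\<in>{1..n}. \<Prod>r\<in>{kap j<..lam j}. ?b (r + (?N - j))) *
      (\<Prod>j\<in>{1..n}. \<Prod>r\<in>{mu j<..kap j}. ?c (r + (?N - j))) *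
      ((\<Prod>r\<in>{k<..lam ?N}. ?b r) * (\<Prod>r\<in>{1<..k}. ?c r)) *
      alternant n (?p (\<lambda>m. a (m - 1))) mu) = 
      (\<Prod>j\<in>{1..n}. \<Prod>r\<in>{kap j<..lam j}. ?b (r + (?N - j))) *
      (\<Prod>j\<in>{1..n}. \<Prod>r\<in>{mu j<..kap j}. ?c (r + (?N - j))) *
      ((factorial_power a ?y (last_row_bound n lam mu)
        - factorial_power a ?yb (last_row_bound n lam mu)) *
       (\<Prod>r\<in>{last_row_bound n lam mu<..lam ?N}. ?b r)) *
      alternant n (?p (\<lambda>m. a (m - 1))) mu"
      unfolding last_row_telescope[OF M, symmetric]
      by (simp add: sum_distrib_left sum_distrib_right mult_ac)
  qed
  finally show ?thesis .
qed

section \<open>The denominator as a product of differences\<close>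

definition pair_product :: "nat \<Rightarrow> (nat \<Rightarrow> 'a::comm_ring_1) \<Rightarrow> 'a" where
  "pair_product n c = (\<Prod>m<n. \<Prod>i<m. c (Suc i) - c (Suc m))"

text \<open>The branching is applied to the sequence of ones. Every interlacing set is then a
  singleton and every product over a strip is empty, so a step contributes only the factors
  \<open>?C i\<close>. The hypothesis on \<open>a\<close> covers all \<open>m \<le> 0\<close>, so it
  passes to the shifted parameters.\<close>

lemma alternant_sum_power:
  fixes x xb :: "nat \<Rightarrow> 'a::comm_ring_1"
  assumes inv: "\<And>k. k \<in> {1..n} \<Longrightarrow> x k * xb k = 1" and a0: "\<And>m. m \<le> 0 \<Longrightarrow> a m = 0"
    and one: "\<And>j. j \<in> {1..n} \<Longrightarrow> lam j = 1"
  shows "alternant n (sum_power x xb a) lam = pair_product n (\<lambda>k. x k + xb k)"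
  using assms
proof (induction n arbitrary: a lam)
  case 0
  then show ?case by (simp add: alternant_def pair_product_def)
next
  case (Suc n)
  let ?N = "Suc n"
  let ?y = "x ?N" and ?yb = "xb ?N"
  \<comment> \<open>The entry of exponent 1 in \<open>sum_power\<close> is halved, so the recurrence
    at \<open>r = 2\<close> needs a doubled coefficient; \<open>?c\<close> at 2 is the difference of
    \<open>g 2\<close> and \<open>h 2\<close>, because \<open>g 1 = 1\<close>.\<close>
  let ?b = "\<lambda>r. if r = 2 then 2 * (?yb + a 1) else ?yb + a (int r - 1)"
    and ?c = "\<lambda>r. if r = 2 then ?y - ?yb else ?y + a (int r - 2)"
  let ?p = "sum_power x xb"
  define g where "g k i = (if k = 0 then 0 else if k = 1 then 1 else
     (x (Suc i) - ?yb) * factorial_power a (x (Suc i)) (k - 2)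
     + (xb (Suc i) - ?yb) * factorial_power a (xb (Suc i)) (k - 2))" for k i
  define h where "h k i = (if k = 1 then 1 else if k = 2 then (x (Suc i) + xb (Suc i)) - (?y + ?yb) else
     (x (Suc i) - ?yb) * (x (Suc i) - ?y) * factorial_power a (x (Suc i)) (k - 3)
     + (xb (Suc i) - ?yb) * (xb (Suc i) - ?y) * factorial_power a (xb (Suc i)) (k - 3))" for k i
  let ?C = "\<lambda>i. (x (Suc i) + xb (Suc i)) - (?y + ?yb)"
  have a00: "a 0 = 0" using Suc.prems by simp
  have yy: "?y * ?yb = 1" "?yb * ?y = 1" using Suc.prems(1)[of ?N] by (auto simp: mult.commute)
  have quad: "(u - ?yb) * (u - ?y) = u * ((u + v) - (?y + ?yb))" if "u * v = 1" for u v
  proof -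
    have "(u - ?yb) * (u - ?y) = u * u - u * ?y - u * ?yb + ?yb * ?y" by (simp add: algebra_simps)
    also have "\<dots> = u * u - u * ?y - u * ?yb + u * v" using that yy by simp
    finally show ?thesis by (simp add: algebra_simps)
  qed
  \<comment> \<open>When all parts are 1, the lower bound \<open>next_part\<close> meets the upper
    bound in every position.\<close>
  have single: "interlacing m nu = {\<lambda>j\<in>{1..m}. 1}" if "\<And>j. j \<in> {1..m} \<Longrightarrow> nu j = 1" for m nu
  proof -
    have "interlacing m nu = (\<Pi>\<^sub>E j\<in>{1..m}. {1})"
      unfolding interlacing_def by (rule PiE_cong) (use that in \<open>auto simp: next_part_def\<close>)
    then show ?thesis by simp
  qed
  have "alternant ?N (?p a) lam = h 1 n * (\<Prod>i<n. ?C i) *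
    (\<Sum>kap\<in>interlacing ?N lam. \<Sum>mu\<in>{mu \<in> interlacing ?N kap. mu ?N = 1}.
      (\<Prod>j\<in>{1..?N}. \<Prod>r\<in>{kap j<..lam j}. ?b (r + (?N - j))) *
      (\<Prod>j\<in>{1..?N}. \<Prod>r\<in>{mu j<..kap j}. ?c (r + (?N - j))) * alternant n (?p (\<lambda>m. a (m - 1))) mu)"
  proof (rule alternant_branching[where g = g and h = h and b = ?b and c = ?c])
    fix k i assume "i \<le> n"
    consider "k = 0" | "k = 1" | m where "k = Suc (Suc m)" by (metis One_nat_def not0_implies_Suc)
    note cs = this
    show "?p a (Suc k) i = g (Suc k) i + ?b (Suc k) * ?p a k i"
      using cs by cases (simp_all add: sum_power_def g_def factorial_power_Suc algebra_simps)
    show "g (Suc k) i = h (Suc k) i + ?c (Suc k) * g k i"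
      using cs by cases (simp_all add: g_def h_def factorial_power_Suc algebra_simps)
  next
    fix k :: nat assume "2 \<le> k"
    then show "h k n = 0" by (simp add: h_def)
  next
    fix k i :: nat assume k: "1 \<le> k" and i: "i < n"
    have xx: "x (Suc i) * xb (Suc i) = 1" "xb (Suc i) * x (Suc i) = 1"
      using Suc.prems(1)[of "Suc i"] i by (auto simp: mult.commute)
    consider "k = 1" | m where "k = Suc (Suc m)" using k
      by (metis One_nat_def not0_implies_Suc not_one_le_zero)
    then show "h (Suc k) i = ?C i * ?p (\<lambda>m. a (m - 1)) k i"
      by cases (simp_all add: h_def sum_power_def factorial_power_shift[where a = a, OF a00] quad[OF xx(1)] quad[OF xx(2)],
        simp add: algebra_simps)
  next
    fix j assume "j \<in> {1..n}"
    then have "lam j = 1" "lam (Suc j) = 1" using Suc.prems(3)[of j] Suc.prems(3)[of "Suc j"] by auto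
    then show "lam (Suc j) \<le> lam j" by simp
  qed (use Suc.prems in \<open>simp_all add: sum_power_def g_def\<close>)
  also have "\<dots> = (\<Prod>i<n. ?C i) * pair_product n (\<lambda>k. x k + xb k)"
  proof -
    let ?u = "\<lambda>j\<in>{1..?N}. 1::nat"
    have 1: "interlacing ?N lam = {?u}" using Suc.prems(3) by (rule single)
    have 2: "interlacing ?N ?u = {?u}" by (rule single) simp
    have 3: "{mu \<in> interlacing ?N ?u. mu ?N = 1} = {?u}" unfolding 2 by auto
    have 4: "alternant n (?p (\<lambda>m. a (m - 1))) ?u = pair_product n (\<lambda>k. x k + xb k)"
      by (rule Suc.IH) (use Suc.prems in auto)
    have 5: "(\<Prod>j\<in>{1..?N}. \<Prod>r\<in>{?u j<..lam j}. ?b (r + (?N - j))) = 1"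
      by (rule prod.neutral) (use Suc.prems(3) in auto)
    have 6: "(\<Prod>j\<in>{1..?N}. \<Prod>r\<in>{?u j<..?u j}. ?c (r + (?N - j))) = 1"
      by (rule prod.neutral) auto
    have 7: "h 1 n = 1" by (simp add: h_def)
    have S: "(\<Sum>kap\<in>interlacing ?N lam. \<Sum>mu\<in>{mu \<in> interlacing ?N kap. mu ?N = 1}. G kap mu) = G ?u ?u"
      for G :: "(nat \<Rightarrow> nat) \<Rightarrow> (nat \<Rightarrow> nat) \<Rightarrow> 'a"
      unfolding 1 by (simp add: 3 del: One_nat_def)
    show ?thesis unfolding S 4 5 6 7 by simp
  qed
  \<comment> \<open>\<open>pair_product\<close> groups the differences by the larger index, so the
    product over \<open>i < n\<close> is its newest factor.\<close>
  finally show ?case by (simp add: pair_product_def mult.commute)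
qed

subsection \<open>Branching of the tableaux\<close>

definition shape :: "nat \<Rightarrow> (nat \<Rightarrow> nat) \<Rightarrow> (nat \<times> nat) set" where
  "shape n mu = (SIGMA i:{1..n}. {1..mu i})"

text \<open>The tableaux are recast for shapes given by functions, since the induction passes
  through the sequences \<open>mu\<close>. The two column conditions are merged into strict
  increase, and the condition relating \<open>k\<close> and barred \<open>k\<close> in row
  \<open>k\<close> has all its quantifiers in front.\<close>

definition eod_fillings :: "nat \<Rightarrow> (nat \<Rightarrow> nat) \<Rightarrow> (nat \<times> nat \<Rightarrow> letter) set" where
  "eod_fillings n mu = {T \<in> shape n mu \<rightarrow>\<^sub>E alphabet n.
     (\<forall>i j j'. (i, j) \<in> shape n mu \<and> (i, j') \<in> shape n mu \<and> j \<le> j' \<longrightarrow> T (i, j) \<le> T (i, j')) \<and>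
     (\<forall>i i' j. (i, j) \<in> shape n mu \<and> (i', j) \<in> shape n mu \<and> i < i' \<longrightarrow> T (i, j) < T (i', j)) \<and>
     (\<forall>i j k. (i, j) \<in> shape n mu \<and> T (i, j) \<in> {Unbarred k, Barred k} \<longrightarrow> i \<le> k) \<and>
     (\<forall>k j j'. (k, j) \<in> shape n mu \<and> (k, j') \<in> shape n mu \<and> T (k, j) = Unbarred k \<and> T (k, j') = Barred k
        \<longrightarrow> (k - 1, j') \<in> shape n mu \<and> T (k - 1, j') = Unbarred k) \<and>
     (\<forall>k \<in> {1..n}. T (k, 1) \<in> {Unbarred k, Barred k})}"

lemma shape_iff: "(i, j) \<in> shape n mu \<longleftrightarrow> i \<in> {1..n} \<and> j \<in> {1..mu i}"
  by (simp add: shape_def)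

lemma finite_shape [simp]: "finite (shape n mu)"
  by (simp add: shape_def)

lemma eod_fillingsD:
  assumes "T \<in> eod_fillings n mu"
  shows "(i, j) \<in> shape n mu \<Longrightarrow> T (i, j) \<in> alphabet n"
    and "p \<notin> shape n mu \<Longrightarrow> T p = undefined"
    and "(i, j) \<in> shape n mu \<Longrightarrow> (i, j') \<in> shape n mu \<Longrightarrow> j \<le> j' \<Longrightarrow> T (i, j) \<le> T (i, j')"
    and "(i, j) \<in> shape n mu \<Longrightarrow> (i', j) \<in> shape n mu \<Longrightarrow> i < i' \<Longrightarrow> T (i, j) < T (i', j)"
    and "(i, j) \<in> shape n mu \<Longrightarrow> T (i, j) = Unbarred k \<or> T (i, j) = Barred k \<Longrightarrow> i \<le> k"
    and "(k, j) \<in> shape n mu \<Longrightarrow> (k, j') \<in> shape n mu \<Longrightarrow> T (k, j) = Unbarred k \<Longrightarrow> T (k, j') = Barred k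
      \<Longrightarrow> (k - 1, j') \<in> shape n mu \<and> T (k - 1, j') = Unbarred k"
    and "k \<in> {1..n} \<Longrightarrow> T (k, 1) = Unbarred k \<or> T (k, 1) = Barred k"
proof -
  note a = assms[unfolded eod_fillings_def mem_Collect_eq]
  note rows = a[THEN conjunct2, THEN conjunct1, rule_format]
    and cols = a[THEN conjunct2, THEN conjunct2, THEN conjunct1, rule_format]
    and flag = a[THEN conjunct2, THEN conjunct2, THEN conjunct2, THEN conjunct1, rule_format]
    and orth = a[THEN conjunct2, THEN conjunct2, THEN conjunct2, THEN conjunct2, THEN conjunct1, rule_format]
    and first = a[THEN conjunct2, THEN conjunct2, THEN conjunct2, THEN conjunct2, THEN conjunct2, rule_format]
  show "(i, j) \<in> shape n mu \<Longrightarrow> T (i, j) \<in> alphabet n"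
    by (rule PiE_mem[OF a[THEN conjunct1]])
  show "p \<notin> shape n mu \<Longrightarrow> T p = undefined"
    by (rule PiE_arb[OF a[THEN conjunct1]])
  show "(i, j) \<in> shape n mu \<Longrightarrow> (i, j') \<in> shape n mu \<Longrightarrow> j \<le> j' \<Longrightarrow> T (i, j) \<le> T (i, j')"
    using rows by simp
  show "(i, j) \<in> shape n mu \<Longrightarrow> (i', j) \<in> shape n mu \<Longrightarrow> i < i' \<Longrightarrow> T (i, j) < T (i', j)"
    using cols by simp
  show "(i, j) \<in> shape n mu \<Longrightarrow> T (i, j) = Unbarred k \<or> T (i, j) = Barred k \<Longrightarrow> i \<le> k"
    using flag[of i j k] by simp
  show "(k, j) \<in> shape n mu \<Longrightarrow> (k, j') \<in> shape n mu \<Longrightarrow> T (k, j) = Unbarred k \<Longrightarrow> T (k, j') = Barred k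
      \<Longrightarrow> (k - 1, j') \<in> shape n mu \<and> T (k - 1, j') = Unbarred k"
    using orth[of k j j'] by simp
  show "k \<in> {1..n} \<Longrightarrow> T (k, 1) = Unbarred k \<or> T (k, 1) = Barred k"
    using first[of k] by simp
qed

lemma eod_fillingsI:
  assumes "T \<in> shape n mu \<rightarrow>\<^sub>E alphabet n"
    and "\<And>i j j'. (i, j) \<in> shape n mu \<Longrightarrow> (i, j') \<in> shape n mu \<Longrightarrow> j \<le> j' \<Longrightarrow> T (i, j) \<le> T (i, j')"
    and "\<And>i i' j. (i, j) \<in> shape n mu \<Longrightarrow> (i', j) \<in> shape n mu \<Longrightarrow> i < i' \<Longrightarrow> T (i, j) < T (i', j)"
    and flag: "\<And>i j k. (i, j) \<in> shape n mu \<Longrightarrow> T (i, j) = Unbarred k \<or> T (i, j) = Barred k \<Longrightarrow> i \<le> k"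
    and orth: "\<And>k j j'. (k, j) \<in> shape n mu \<Longrightarrow> (k, j') \<in> shape n mu \<Longrightarrow> T (k, j) = Unbarred k \<Longrightarrow>
      T (k, j') = Barred k \<Longrightarrow> (k - 1, j') \<in> shape n mu \<and> T (k - 1, j') = Unbarred k"
    and first: "\<And>k. k \<in> {1..n} \<Longrightarrow> T (k, 1) = Unbarred k \<or> T (k, 1) = Barred k"
  shows "T \<in> eod_fillings n mu"
  unfolding eod_fillings_def mem_Collect_eq
proof (intro conjI allI impI ballI)
  fix i j k assume "(i, j) \<in> shape n mu \<and> T (i, j) \<in> {Unbarred k, Barred k}"
  then show "i \<le> k" using flag[of i j k] by simp
next
  fix k assume "k \<in> {1..n}"
  then show "T (k, 1) \<in> {Unbarred k, Barred k}" using first by simp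
next
  fix k j j' assume "(k, j) \<in> shape n mu \<and> (k, j') \<in> shape n mu \<and> T (k, j) = Unbarred k \<and> T (k, j') = Barred k"
  then show "(k - 1, j') \<in> shape n mu" "T (k - 1, j') = Unbarred k" using orth[of k j j'] by simp_all
qed (use assms(1-3) in simp_all)

section \<open>Adding the two largest letters to a filling\<close>

lemma letter_simps [simp]:
  "Unbarred k < Barred k" "Unbarred k \<le> Barred k" "\<not> Barred k \<le> Unbarred k" "\<not> Barred k < Unbarred k"
  by (auto simp: less_letter_def less_eq_letter_def)

lemma alphabet_Suc: "t \<in> alphabet (Suc n) \<longleftrightarrow> t \<in> alphabet n \<or> t = Unbarred (Suc n) \<or> t = Barred (Suc n)"
  by (cases t) (auto simp: alphabet_def image_iff)

lemma alphabet_less: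
  assumes "t \<in> alphabet n"
  shows "t < Unbarred (Suc n)" and "t < Barred (Suc n)"
  using assms by (auto simp: alphabet_def less_letter_def)

text \<open>The two new letters are the largest ones, so comparison with them decides whether a
  letter is old, unbarred \<open>Suc n\<close> or barred \<open>Suc n\<close>.\<close>

lemma alphabet_below:
  assumes "t \<in> alphabet (Suc n)"
  shows "t < Unbarred (Suc n) \<longleftrightarrow> t \<in> alphabet n"
    and "t \<le> Unbarred (Suc n) \<longleftrightarrow> t \<in> alphabet n \<or> t = Unbarred (Suc n)"
    and "t < Barred (Suc n) \<longleftrightarrow> t \<le> Unbarred (Suc n)"
    and "t \<le> Barred (Suc n)"
proof -
  show 1: "t < Unbarred (Suc n) \<longleftrightarrow> t \<in> alphabet n"
    using assms alphabet_less(1)[of t n] unfolding alphabet_Suc by auto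
  show "t \<le> Unbarred (Suc n) \<longleftrightarrow> t \<in> alphabet n \<or> t = Unbarred (Suc n)"
    using 1 by (auto simp: le_less)
  show "t < Barred (Suc n) \<longleftrightarrow> t \<le> Unbarred (Suc n)"
    by (auto simp: less_letter_def less_eq_letter_def)
  show "t \<le> Barred (Suc n)"
    using assms alphabet_less(2)[of t n] unfolding alphabet_Suc by auto
qed

text \<open>Here \<open>mu\<close> is the shape of the smaller filling, \<open>kap\<close> bounds the unbarred letters \<open>Suc n\<close> in the
  rows above the last one, and \<open>k\<close> is the number of unbarred letters in the last row.\<close>

definition extend_filling :: "nat \<Rightarrow> (nat \<Rightarrow> nat) \<Rightarrow> (nat \<Rightarrow> nat) \<Rightarrow> (nat \<Rightarrow> nat) \<Rightarrow> nat \<Rightarrow>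
    (nat \<times> nat \<Rightarrow> letter) \<Rightarrow> nat \<times> nat \<Rightarrow> letter" where
  "extend_filling n lam kap mu k T = (\<lambda>(i, j)\<in>shape (Suc n) lam.
     if i \<le> n \<and> j \<le> mu i then T (i, j)
     else if j \<le> (if i \<le> n then kap i else k) then Unbarred (Suc n) else Barred (Suc n))"

lemma inner_stripsD:
  "kap \<in> inner_strips n lam \<Longrightarrow> j \<in> {1..n} \<Longrightarrow> lam (Suc j) \<le> kap j \<and> kap j \<le> lam j"
  "kap \<in> inner_strips n lam \<Longrightarrow> j \<notin> {1..n} \<Longrightarrow> kap j = undefined"
proof -
  show "lam (Suc j) \<le> kap j \<and> kap j \<le> lam j" if "kap \<in> inner_strips n lam" "j \<in> {1..n}"
    using PiE_mem[OF that[unfolded inner_strips_def]] by simp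
  show "kap j = undefined" if "kap \<in> inner_strips n lam" "j \<notin> {1..n}"
    using PiE_arb[OF that[unfolded inner_strips_def]] .
qed

lemma interlacingD:
  "mu \<in> interlacing n kap \<Longrightarrow> j \<in> {1..n} \<Longrightarrow> next_part n kap j \<le> mu j \<and> mu j \<le> kap j"
  "mu \<in> interlacing n kap \<Longrightarrow> j \<notin> {1..n} \<Longrightarrow> mu j = undefined"
proof -
  show "next_part n kap j \<le> mu j \<and> mu j \<le> kap j" if "mu \<in> interlacing n kap" "j \<in> {1..n}"
    using PiE_mem[OF that[unfolded interlacing_def]] by simp
  show "mu j = undefined" if "mu \<in> interlacing n kap" "j \<notin> {1..n}"
    using PiE_arb[OF that[unfolded interlacing_def]] .
qed

text \<open>The data of one extension. Once the last row contains an unbarred \<open>Suc n\<close>,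
  each barred one there must sit below an unbarred \<open>Suc n\<close>; with column strictness this
  leaves only the two values of \<open>k\<close> for the number of unbarred letters in that
  row.\<close>

locale strip_data =
  fixes n :: nat and lam kap mu :: "nat \<Rightarrow> nat" and k :: nat
  assumes lam_pos: "\<And>j. j \<in> {1..Suc n} \<Longrightarrow> 1 \<le> lam j"
    and lam_dec: "\<And>j. j \<in> {1..n} \<Longrightarrow> lam (Suc j) \<le> lam j"
    and kap: "kap \<in> inner_strips n lam"
    and mu: "mu \<in> interlacing n kap"
    and k: "k \<in> {0, last_row_bound n lam mu}"
begin

lemma kap_bounds: "j \<in> {1..n} \<Longrightarrow> lam (Suc j) \<le> kap j" "j \<in> {1..n} \<Longrightarrow> kap j \<le> lam j"
  using inner_stripsD(1)[OF kap] by auto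

lemma mu_le: "j \<in> {1..n} \<Longrightarrow> mu j \<le> kap j"
  using interlacingD(1)[OF mu] by auto

lemma mu_pos: "j \<in> {1..n} \<Longrightarrow> 1 \<le> mu j"
  by (rule interlacing_pos[OF _ mu])
    (meson Suc_le_mono atLeastAtMost_iff kap_bounds(1) lam_pos le_SucI le_trans)+

lemma mu_ge: "j \<in> {1..n} \<Longrightarrow> Suc j \<in> {1..n} \<Longrightarrow> kap (Suc j) \<le> mu j"
  using interlacingD(1)[OF mu, of j] by (simp add: next_part_def)

lemma k_le: "k \<le> lam (Suc n)"
  using k by (auto simp: last_row_bound_def)

lemma mu_dec: "j \<in> {1..n} \<Longrightarrow> Suc j \<in> {1..n} \<Longrightarrow> mu (Suc j) \<le> mu j"
  using mu_ge mu_le le_trans by blast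

lemma lam_antimono:
  assumes "i \<le> i'" and "i \<in> {1..Suc n}" and "i' \<in> {1..Suc n}"
  shows "lam i' \<le> lam i"
  using assms
proof (induction i' rule: dec_induct)
  case (step m)
  then show ?case using lam_dec[of m] by auto
qed simp

lemma mu_antimono:
  assumes "i \<le> i'" and "i \<in> {1..n}" and "i' \<in> {1..n}"
  shows "mu i' \<le> mu i"
  using assms
proof (induction i' rule: dec_induct)
  case (step m)
  then show ?case using mu_dec[of m] by auto
qed simp

lemma mu_le_lam: "j \<in> {1..n} \<Longrightarrow> mu j \<le> lam j"
  using mu_le kap_bounds(2) le_trans by blast

lemma shape_mono: "p \<in> shape n mu \<Longrightarrow> p \<in> shape (Suc n) lam"
  using mu_le_lam by (cases p) (force simp: shape_iff)

text \<open>Column strictness for the unbarred letters \<open>Suc n\<close>: whatever stands above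
  one of them is an old letter.\<close>

lemma mu_strict:
  assumes "i < i'" "i \<in> {1..n}" "i' \<in> {1..Suc n}"
  shows "(if i' \<le> n then kap i' else k) \<le> mu i"
proof (cases "i' \<le> n")
  case True
  then obtain m where m: "i' = Suc m" "i \<le> m" using assms(1) by (cases i') auto
  then have "kap i' \<le> mu m" using mu_ge[of m] assms True by auto
  also have "\<dots> \<le> mu i" using mu_antimono[of i m] m assms True by auto
  finally show ?thesis using True by simp
next
  case False
  then have "k \<le> mu n" using k assms by (auto simp: last_row_bound_def)
  also have "\<dots> \<le> mu i" using mu_antimono[of i n] assms by auto
  finally show ?thesis using False by simp
qed

text \<open>Column strictness for the barred letters \<open>Suc n\<close>: no cell above another
  cell of the shape holds one.\<close>

lemma kap_strict:
  assumes "i < i'" "i \<in> {1..n}" "i' \<in> {1..Suc n}"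
  shows "lam i' \<le> kap i"
  using lam_antimono[of "Suc i" i'] kap_bounds(1)[of i] assms by auto

lemma extend_filling_simps:
  assumes "(i, j) \<in> shape (Suc n) lam"
  shows "i \<le> n \<Longrightarrow> j \<le> mu i \<Longrightarrow> extend_filling n lam kap mu k T (i, j) = T (i, j)"
    and "i \<le> n \<Longrightarrow> mu i < j \<Longrightarrow> j \<le> kap i \<Longrightarrow> extend_filling n lam kap mu k T (i, j) = Unbarred (Suc n)"
    and "i \<le> n \<Longrightarrow> kap i < j \<Longrightarrow> extend_filling n lam kap mu k T (i, j) = Barred (Suc n)"
    and "i = Suc n \<Longrightarrow> j \<le> k \<Longrightarrow> extend_filling n lam kap mu k T (i, j) = Unbarred (Suc n)"
    and "i = Suc n \<Longrightarrow> k < j \<Longrightarrow> extend_filling n lam kap mu k T (i, j) = Barred (Suc n)"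
  using assms mu_le[of i] by (auto simp: extend_filling_def shape_iff)

lemma extend_filling_cases:
  assumes "(i, j) \<in> shape (Suc n) lam"
  obtains (old) "i \<le> n" "j \<le> mu i" "(i, j) \<in> shape n mu" "extend_filling n lam kap mu k T (i, j) = T (i, j)"
  | (unbarred) "i \<le> n \<Longrightarrow> mu i < j" "j \<le> (if i \<le> n then kap i else k)"
      "extend_filling n lam kap mu k T (i, j) = Unbarred (Suc n)"
  | (barred) "(if i \<le> n then kap i else k) < j" "extend_filling n lam kap mu k T (i, j) = Barred (Suc n)"
proof -
  consider "i \<le> n" "j \<le> mu i" | "i \<le> n" "mu i < j" "j \<le> kap i" | "i \<le> n" "kap i < j"
    | "i = Suc n" "j \<le> k" | "i = Suc n" "k < j"
    using assms by (fastforce simp: shape_iff)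
  then show ?thesis
  proof cases
    case 1
    then show ?thesis using extend_filling_simps(1)[OF assms] assms by (intro old) (auto simp: shape_iff)
  next
    case 2
    then show ?thesis using extend_filling_simps(2)[OF assms] by (intro unbarred) auto
  next
    case 3
    then show ?thesis using extend_filling_simps(3)[OF assms] by (intro barred) auto
  next
    case 4
    then show ?thesis using extend_filling_simps(4)[OF assms] by (intro unbarred) auto
  next
    case 5
    then show ?thesis using extend_filling_simps(5)[OF assms] by (intro barred) auto
  qed
qed

text \<open>The regions cut out by \<open>mu\<close>, \<open>kap\<close> and \<open>k\<close> can be
  read off the extended filling by comparison with \<open>Unbarred (Suc n)\<close>. This serves the
  order conditions and also the uniqueness of the data.\<close>

lemma extend_filling_less_iff:
  assumes T: "T \<in> eod_fillings n mu" and ij: "(i, j) \<in> shape (Suc n) lam"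
  shows "extend_filling n lam kap mu k T (i, j) < Unbarred (Suc n) \<longleftrightarrow> i \<le> n \<and> j \<le> mu i"
    and "extend_filling n lam kap mu k T (i, j) \<le> Unbarred (Suc n) \<longleftrightarrow> j \<le> (if i \<le> n then kap i else k)"
proof -
  have "(extend_filling n lam kap mu k T (i, j) < Unbarred (Suc n) \<longleftrightarrow> i \<le> n \<and> j \<le> mu i) \<and>
    (extend_filling n lam kap mu k T (i, j) \<le> Unbarred (Suc n) \<longleftrightarrow> j \<le> (if i \<le> n then kap i else k))"
    using ij
  proof (cases rule: extend_filling_cases[where T = T])
    case old
    then have "T (i, j) < Unbarred (Suc n)"
      using alphabet_less(1) eod_fillingsD(1)[OF T] by blast
    moreover have "mu i \<le> kap i" using old ij by (intro mu_le) (auto simp: shape_iff)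
    ultimately show ?thesis using old by auto
  next
    case unbarred
    then show ?thesis by auto
  next
    case barred
    moreover have "i \<le> n \<Longrightarrow> mu i \<le> kap i" using ij by (intro mu_le) (auto simp: shape_iff)
    ultimately show ?thesis by auto
  qed
  then show "extend_filling n lam kap mu k T (i, j) < Unbarred (Suc n) \<longleftrightarrow> i \<le> n \<and> j \<le> mu i"
    "extend_filling n lam kap mu k T (i, j) \<le> Unbarred (Suc n) \<longleftrightarrow> j \<le> (if i \<le> n then kap i else k)" by auto
qed

lemma extend_filling_in:
  assumes T: "T \<in> eod_fillings n mu"
  shows "extend_filling n lam kap mu k T \<in> eod_fillings (Suc n) lam" (is "?E \<in> _")
proof -
  let ?N = "Suc n"
  let ?S = "shape ?N lam"
  have old_lt: "T p < Unbarred ?N" "T p < Barred ?N" "T p \<in> alphabet n" if "p \<in> shape n mu" for p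
    using that eod_fillingsD(1)[OF T, of "fst p" "snd p"] by (simp_all add: alphabet_less)
  have alph: "?E (i, j) \<in> alphabet ?N" if "(i, j) \<in> ?S" for i j
    using that by (cases rule: extend_filling_cases[where T = T]) (auto simp: alphabet_Suc old_lt)
  have rows: "?E (i, j) \<le> ?E (i, j')" if ij: "(i, j) \<in> ?S" and ij': "(i, j') \<in> ?S" and "j \<le> j'" for i j j'
    using ij'
  proof (cases rule: extend_filling_cases[where T = T])
    case old
    then have "(i, j) \<in> shape n mu" using that by (auto simp: shape_iff)
    then show ?thesis using old that eod_fillingsD(3)[OF T] extend_filling_simps(1)[OF ij] by auto
  next
    case unbarred
    then show ?thesis using extend_filling_less_iff(2)[OF T ij] that by auto
  next
    case barred
    then show ?thesis using alphabet_below(4)[OF alph[OF ij]] by simp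
  qed
  have cols: "?E (i, j) < ?E (i', j)" if ij: "(i, j) \<in> ?S" and ij': "(i', j) \<in> ?S" and "i < i'" for i i' j
  proof -
    have ii: "i \<in> {1..n}" "i' \<in> {1..?N}" and j: "j \<in> {1..lam i'}" using that by (auto simp: shape_iff)
    from ij' show ?thesis
    proof (cases rule: extend_filling_cases[where T = T])
      case old
      then have "j \<le> mu i" using mu_antimono[of i i'] ii \<open>i < i'\<close> by auto
      then have "(i, j) \<in> shape n mu" using ii j by (auto simp: shape_iff)
      then show ?thesis
        using old eod_fillingsD(4)[OF T] extend_filling_simps(1)[OF ij] \<open>j \<le> mu i\<close> ii \<open>i < i'\<close> by auto
    next
      case unbarred
      then have "j \<le> mu i" using mu_strict[OF \<open>i < i'\<close> ii] by simp
      then show ?thesis using unbarred extend_filling_less_iff(1)[OF T ij] ii by auto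
    next
      case barred
      have "j \<le> kap i" using kap_strict[OF \<open>i < i'\<close> ii] j by auto
      then show ?thesis
        using barred extend_filling_less_iff(2)[OF T ij] ii alphabet_below(3)[OF alph[OF ij]] by auto
    qed
  qed
  have flag: "i \<le> m" if ij: "(i, j) \<in> ?S" and "?E (i, j) = Unbarred m \<or> ?E (i, j) = Barred m" for i j m
    using ij
  proof (cases rule: extend_filling_cases[where T = T])
    case old
    then show ?thesis using that eod_fillingsD(5)[OF T] by auto
  qed (use that in \<open>auto simp: shape_iff\<close>)
  have orth: "(m - 1, j') \<in> ?S \<and> ?E (m - 1, j') = Unbarred m"
    if mj: "(m, j) \<in> ?S" and mj': "(m, j') \<in> ?S" and u: "?E (m, j) = Unbarred m" and b: "?E (m, j') = Barred m"
    for m j j'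
  proof (cases "m \<le> n")
    case True
    have "(m, j) \<in> shape n mu \<and> T (m, j) = Unbarred m"
      using mj by (cases rule: extend_filling_cases[where T = T]) (use u True in auto)
    then have o: "(m, j) \<in> shape n mu" "T (m, j) = Unbarred m" by auto
    have "(m, j') \<in> shape n mu \<and> T (m, j') = Barred m"
      using mj' by (cases rule: extend_filling_cases[where T = T]) (use b True in auto)
    then have o': "(m, j') \<in> shape n mu" "T (m, j') = Barred m" by auto
    have "(m - 1, j') \<in> shape n mu \<and> T (m - 1, j') = Unbarred m"
      using eod_fillingsD(6)[OF T o(1) o'(1) o(2) o'(2)] .
    then show ?thesis using extend_filling_simps(1)[of "m - 1" j' T] shape_mono by (auto simp: shape_iff)
  next
    case False
    then have m: "m = ?N" using mj by (auto simp: shape_iff)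
    have jk: "j \<le> k" using u extend_filling_simps(5)[OF mj m] by (cases "j \<le> k") auto
    have jk': "k < j'" using b extend_filling_simps(4)[OF mj' m] by (cases "k < j'") auto
    \<comment> \<open>Both kinds of letter occur in the last row, so \<open>k\<close> is neither 0
      nor \<open>lam (Suc n)\<close>; hence \<open>k = mu n\<close>. The cell above column
      \<open>j'\<close> lies beyond \<open>mu n\<close> and within \<open>kap n\<close>, so it is
      unbarred.\<close>
    have "1 \<le> j" "j' \<le> lam ?N" using mj mj' m by (auto simp: shape_iff)
    then have n: "n \<noteq> 0" "k = mu n" using k jk jk' by (auto simp: last_row_bound_def split: if_splits)
    have "j' \<le> kap n" using kap_bounds(1)[of n] n \<open>j' \<le> lam ?N\<close> by auto
    moreover have "(n, j') \<in> ?S" using n \<open>j' \<le> lam ?N\<close> lam_dec[of n] mj' by (auto simp: shape_iff)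
    ultimately show ?thesis using extend_filling_simps(2)[of n j' T] jk' n m by auto
  qed
  have first: "?E (m, 1) = Unbarred m \<or> ?E (m, 1) = Barred m" if "m \<in> {1..?N}" for m
  proof -
    have S: "(m, 1) \<in> ?S" using that lam_pos[of m] by (auto simp: shape_iff)
    show ?thesis
    proof (cases "m = ?N")
      case True
      then show ?thesis using extend_filling_simps(4,5)[OF S True, of T] by (cases "1 \<le> k") auto
    next
      case False
      with that have "m \<in> {1..n}" by auto
      then show ?thesis using extend_filling_simps(1)[OF S, of T] mu_pos[of m] eod_fillingsD(7)[OF T, of m] by auto
    qed
  qed
  have "?E \<in> ?S \<rightarrow>\<^sub>E alphabet ?N"
  proof (rule PiE_I)
    fix p assume "p \<in> ?S"
    then show "?E p \<in> alphabet ?N" using alph by (cases p) auto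
  qed (auto simp: extend_filling_def)
  then show ?thesis
    using rows cols flag orth first by (rule eod_fillingsI)
qed

end

section \<open>Recovering the strips from a filling\<close>

lemma initial_segment:
  fixes P :: "nat \<Rightarrow> bool"
  assumes "\<And>j j'. 1 \<le> j \<Longrightarrow> j \<le> j' \<Longrightarrow> j' \<le> l \<Longrightarrow> P j' \<Longrightarrow> P j"
  shows "\<exists>m\<le>l. \<forall>j\<in>{1..l}. P j \<longleftrightarrow> j \<le> m"
  using assms
proof (induction l)
  case (Suc l)
  show ?case
  proof (cases "P (Suc l)")
    case True
    then show ?thesis using Suc.prems by (intro exI[of _ "Suc l"]) auto
  next
    case False
    obtain m where m: "m \<le> l" "\<forall>j\<in>{1..l}. P j \<longleftrightarrow> j \<le> m"
      using Suc.IH Suc.prems by (metis le_SucI)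
    have "P j \<longleftrightarrow> j \<le> m" if "j \<in> {1..Suc l}" for j
      using that m False by (cases "j = Suc l") auto
    then show ?thesis using m(1) by (intro exI[of _ m]) auto
  qed
qed simp

lemma initial_segment_eq:
  fixes b c :: nat
  assumes "\<And>j. j \<in> {1..l} \<Longrightarrow> j \<le> b \<longleftrightarrow> j \<le> c" and "b \<le> l" and "c \<le> l"
  shows "b = c"
  using assms(1)[of b] assms(1)[of c] assms(2,3) by (cases "b = 0"; cases "c = 0") auto

lemma finite_eod_fillings [simp]: "finite (eod_fillings n mu)"
  by (rule finite_subset[of _ "shape n mu \<rightarrow>\<^sub>E alphabet n"])
    (auto simp: eod_fillings_def alphabet_def intro!: finite_PiE)

text \<open>Rows increase weakly, so in row \<open>i\<close> the letters below
  \<open>Unbarred (Suc n)\<close>, and those not above it, form initial segments, of lengths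
  \<open>m i\<close> and \<open>q i\<close>. Column strictness gives the interlacing inequalities,
  and the condition on the first column makes \<open>m i\<close> positive for
  \<open>i \<le> n\<close>.\<close>

lemma extend_filling_surj:
  assumes lam_pos: "\<And>j. j \<in> {1..Suc n} \<Longrightarrow> 1 \<le> lam j"
    and lam_dec: "\<And>j. j \<in> {1..n} \<Longrightarrow> lam (Suc j) \<le> lam j"
    and T: "T \<in> eod_fillings (Suc n) lam"
  obtains kap mu k T' where "kap \<in> inner_strips n lam" "mu \<in> interlacing n kap"
    "k \<in> {0, last_row_bound n lam mu}" "T' \<in> eod_fillings n mu" "T = extend_filling n lam kap mu k T'"
proof -
  let ?N = "Suc n"
  let ?S = "shape ?N lam"
  note TD = eod_fillingsD[OF T]
  have "\<exists>m\<le>lam i. \<forall>j\<in>{1..lam i}. T (i, j) < Unbarred ?N \<longleftrightarrow> j \<le> m" if "i \<in> {1..?N}" for i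
    by (rule initial_segment) (use TD(3)[of i] that in \<open>force simp: shape_iff\<close>)
  then obtain m where m: "i \<in> {1..?N} \<Longrightarrow> m i \<le> lam i"
    "i \<in> {1..?N} \<Longrightarrow> j \<in> {1..lam i} \<Longrightarrow> T (i, j) < Unbarred ?N \<longleftrightarrow> j \<le> m i" for i j
    by metis
  have "\<exists>m\<le>lam i. \<forall>j\<in>{1..lam i}. T (i, j) \<le> Unbarred ?N \<longleftrightarrow> j \<le> m" if "i \<in> {1..?N}" for i
    by (rule initial_segment) (use TD(3)[of i] that in \<open>force simp: shape_iff\<close>)
  then obtain q where q: "i \<in> {1..?N} \<Longrightarrow> q i \<le> lam i"
    "i \<in> {1..?N} \<Longrightarrow> j \<in> {1..lam i} \<Longrightarrow> T (i, j) \<le> Unbarred ?N \<longleftrightarrow> j \<le> q i" for i j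
    by metis
  have dec: "lam (Suc i) \<le> lam i" "1 \<le> lam i" if "i \<in> {1..n}" for i
    using lam_dec[of i] lam_pos[of i] that by auto
  have mq: "m i \<le> q i" if "i \<in> {1..?N}" for i
    using m(1)[OF that] m(2)[OF that, of "m i"] q(2)[OF that, of "m i"] by (cases "m i = 0") auto
  \<comment> \<open>The letter in row \<open>Suc i\<close> and column \<open>lam (Suc i)\<close> is
    at most \<open>Barred (Suc n)\<close>, so the letter above it is strictly smaller.\<close>
  have q_ge: "lam (Suc i) \<le> q i" if "i \<in> {1..n}" for i
  proof -
    let ?j = "lam (Suc i)"
    have j: "?j \<in> {1..lam i}" "1 \<le> ?j" using dec[OF that] lam_pos[of "Suc i"] that by auto
    have S: "(i, ?j) \<in> ?S" "(Suc i, ?j) \<in> ?S" using that j by (auto simp: shape_iff)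
    have "T (i, ?j) < Barred ?N"
      using TD(4)[OF S] alphabet_below(4)[OF TD(1)[OF S(2)]] by simp
    then have "T (i, ?j) \<le> Unbarred ?N" using alphabet_below(3)[OF TD(1)[OF S(1)]] by simp
    then show ?thesis using q(2)[of i ?j] j that by simp
  qed
  have m_ge: "q (Suc i) \<le> m i" if "i \<in> {1..n}" for i
  proof (cases "q (Suc i) = 0")
    case False
    let ?j = "q (Suc i)"
    have j: "?j \<in> {1..lam (Suc i)}" "?j \<in> {1..lam i}" using False q(1)[of "Suc i"] dec[OF that] that by auto
    have S: "(i, ?j) \<in> ?S" "(Suc i, ?j) \<in> ?S" using that j by (auto simp: shape_iff)
    have "T (i, ?j) < Unbarred ?N"
      using TD(4)[OF S] q(2)[of "Suc i" ?j] j that by simp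
    then show ?thesis using m(2)[of i ?j] j that by simp
  qed simp
  have m_pos: "1 \<le> m i" if "i \<in> {1..n}" for i
  proof -
    have S: "(i, 1) \<in> ?S" using dec(2)[OF that] that by (auto simp: shape_iff)
    have "T (i, 1) < Unbarred ?N" using TD(7)[of i] that by (auto simp: less_letter_def)
    then show ?thesis using m(2)[of i 1] S by (auto simp: shape_iff)
  qed
  define kap mu k where "kap = restrict q {1..n}" and "mu = restrict m {1..n}" and "k = q ?N"
  define T' where "T' = restrict T (shape n mu)"
  \<comment> \<open>No letter may stand lower than its own row, so row \<open>Suc n\<close> holds
    only the two new letters.\<close>
  have last: "T (?N, j) = Unbarred ?N \<or> T (?N, j) = Barred ?N" if "j \<in> {1..lam ?N}" for j
  proof -
    have S: "(?N, j) \<in> ?S" using that by (auto simp: shape_iff)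
    show ?thesis using TD(1)[OF S] TD(5)[OF S] by (auto simp: alphabet_def)
  qed
  have kap: "kap \<in> inner_strips n lam"
    unfolding inner_strips_def kap_def using q_ge q(1) by auto
  have mu: "mu \<in> interlacing n kap"
    unfolding interlacing_def mu_def
  proof (rule restrict_PiE_iff[THEN iffD2], rule ballI)
    fix j assume j: "j \<in> {1..n}"
    then show "m j \<in> {next_part n kap j..kap j}"
      using m_ge[of j] m_pos[of j] mq[of j] by (auto simp: next_part_def kap_def)
  qed
  \<comment> \<open>If \<open>0 < k < lam (Suc n)\<close>, the barred letter in column
    \<open>Suc k\<close> needs an unbarred \<open>Suc n\<close> above it, hence
    \<open>mu n < Suc k\<close>. Together with \<open>k \<le> mu n\<close> this gives
    \<open>k = mu n\<close>.\<close>
  have k: "k \<in> {0, last_row_bound n lam mu}"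
  proof (cases "k = 0")
    case False
    have kl: "k \<le> lam ?N" using q(1)[of ?N] by (simp add: k_def)
    have km: "n \<noteq> 0 \<Longrightarrow> k \<le> mu n" using m_ge[of n] by (simp add: k_def mu_def)
    show ?thesis
    proof (cases "k = lam ?N")
      case True
      then show ?thesis using km by (auto simp: last_row_bound_def)
    next
      case False
      with kl have lt: "Suc k \<le> lam ?N" by simp
      have S: "(?N, k) \<in> ?S" "(?N, Suc k) \<in> ?S" using lt \<open>k \<noteq> 0\<close> by (auto simp: shape_iff)
      have "T (?N, k) = Unbarred ?N"
        using last[of k] q(2)[of ?N k] S by (auto simp: shape_iff k_def)
      moreover have "T (?N, Suc k) = Barred ?N"
        using last[of "Suc k"] q(2)[of ?N "Suc k"] S by (auto simp: shape_iff k_def)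
      ultimately have "(n, Suc k) \<in> ?S" "T (n, Suc k) = Unbarred ?N"
        using TD(6)[OF S] by auto
      then have "n \<noteq> 0" "\<not> Suc k \<le> mu n"
        using m(2)[of n "Suc k"] by (auto simp: shape_iff mu_def)
      with km lt show ?thesis by (auto simp: last_row_bound_def)
    qed
  qed simp
  have sub: "(i, j) \<in> ?S \<and> i \<le> n \<and> T (i, j) < Unbarred ?N" if "(i, j) \<in> shape n mu" for i j
    using that m(1)[of i] m(2)[of i j] by (auto simp: shape_iff mu_def)
  have sup: "(i, j) \<in> shape n mu" if "(i, j) \<in> ?S" "i \<le> n" "T (i, j) < Unbarred ?N" for i j
    using that m(2)[of i j] by (auto simp: shape_iff mu_def)
  have "T' \<in> eod_fillings n mu"
  proof (rule eod_fillingsI)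
    show "T' \<in> shape n mu \<rightarrow>\<^sub>E alphabet n"
      unfolding T'_def
    proof (rule restrict_PiE_iff[THEN iffD2], rule ballI)
      fix p assume "p \<in> shape n mu"
      then show "T p \<in> alphabet n"
        using sub[of "fst p" "snd p"] alphabet_below(1)[OF TD(1)[of "fst p" "snd p"]] by simp
    qed
  next
    fix i j j' assume "(i, j) \<in> shape n mu" "(i, j') \<in> shape n mu" "j \<le> j'"
    then show "T' (i, j) \<le> T' (i, j')" using TD(3)[of i j j'] sub by (auto simp: T'_def)
  next
    fix i i' j assume "(i, j) \<in> shape n mu" "(i', j) \<in> shape n mu" "i < i'"
    then show "T' (i, j) < T' (i', j)" using TD(4)[of i j i'] sub by (auto simp: T'_def)
  next
    fix i j l assume "(i, j) \<in> shape n mu" "T' (i, j) = Unbarred l \<or> T' (i, j) = Barred l"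
    then show "i \<le> l" using TD(5)[of i j l] sub by (auto simp: T'_def)
  next
    fix l j j' assume *: "(l, j) \<in> shape n mu" "(l, j') \<in> shape n mu" "T' (l, j) = Unbarred l" "T' (l, j') = Barred l"
    then have **: "(l - 1, j') \<in> ?S" "T (l - 1, j') = Unbarred l"
      using TD(6)[of l j j'] sub by (auto simp: T'_def)
    moreover have "l \<le> n" using sub[OF *(1)] by simp
    \<comment> \<open>The letter above is \<open>Unbarred l\<close> with \<open>l \<le> n\<close>,
      an old letter, so its cell belongs to the smaller shape.\<close>
    ultimately have "(l - 1, j') \<in> shape n mu" by (intro sup) (auto simp: less_letter_def)
    with ** show "(l - 1, j') \<in> shape n mu \<and> T' (l - 1, j') = Unbarred l" by (simp add: T'_def)
  next
    fix l assume l: "l \<in> {1..n}"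
    then have "(l, 1) \<in> shape n mu" using m_pos[OF l] by (simp add: shape_iff mu_def)
    then show "T' (l, 1) = Unbarred l \<or> T' (l, 1) = Barred l" using TD(7)[of l] l by (simp add: T'_def)
  qed
  moreover have "T = extend_filling n lam kap mu k T'"
  proof (rule ext)
    fix p :: "nat \<times> nat"
    obtain i j where p: "p = (i, j)" by (cases p)
    interpret strip_data n lam kap mu k
      by unfold_locales (use lam_pos lam_dec kap mu k in auto)
    show "T p = extend_filling n lam kap mu k T' p"
    proof (cases "p \<in> ?S")
      case False
      then show ?thesis using TD(2) by (simp add: extend_filling_def)
    next
      case True
      then have S: "(i, j) \<in> ?S" and ij: "i \<in> {1..?N}" "j \<in> {1..lam i}" by (auto simp: p shape_iff)
      have qk: "(if i \<le> n then kap i else k) = q i"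
        using ij by (auto simp: kap_def k_def le_Suc_eq)
      note b = alphabet_below[OF TD(1)[OF S]]
      have t: "T (i, j) \<in> alphabet n \<or> T (i, j) = Unbarred ?N \<or> T (i, j) = Barred ?N"
        using TD(1)[OF S] by (simp add: alphabet_Suc)
      from S show ?thesis unfolding p
      proof (cases rule: extend_filling_cases[where T = T'])
        case old
        then show "T (i, j) = extend_filling n lam kap mu k T' (i, j)" by (simp add: T'_def)
      next
        case unbarred
        have "\<not> T (i, j) < Unbarred ?N"
        proof (cases "i \<le> n")
          case True
          then show ?thesis using unbarred(1) m(2)[OF ij] ij by (simp add: mu_def)
        next
          case False
          then have "i = ?N" using ij by simp
          then show ?thesis using last[of j] ij by auto
        qed
        moreover have "T (i, j) \<le> Unbarred ?N" using unbarred(2) q(2)[OF ij] qk by simp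
        ultimately show "T (i, j) = extend_filling n lam kap mu k T' (i, j)" using unbarred(3) by simp
      next
        case barred
        then have "\<not> T (i, j) \<le> Unbarred ?N" using q(2)[OF ij] qk by simp
        then show "T (i, j) = extend_filling n lam kap mu k T' (i, j)" using barred(2) b t by auto
      qed
    qed
  qed
  ultimately show thesis using that kap mu k by blast
qed

text \<open>Each of \<open>mu i\<close>, \<open>kap i\<close> and \<open>k\<close> is the length of
  an initial segment of a row that comparison with \<open>Unbarred (Suc n)\<close> singles out, so
  equal fillings have equal lengths. Outside the index sets extensionality fixes the values.\<close>

lemma extend_filling_inj:
  assumes "strip_data n lam kap mu k" and "strip_data n lam kap' mu' k'"
    and T: "T \<in> eod_fillings n mu" and T': "T' \<in> eod_fillings n mu'"
    and eq: "extend_filling n lam kap mu k T = extend_filling n lam kap' mu' k' T'"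
  shows "kap = kap' \<and> mu = mu' \<and> k = k' \<and> T = T'"
proof -
  interpret A: strip_data n lam kap mu k by fact
  interpret B: strip_data n lam kap' mu' k' by fact
  have S: "(i, j) \<in> shape (Suc n) lam" if "i \<in> {1..Suc n}" "j \<in> {1..lam i}" for i j
    using that by (simp add: shape_iff)
  have "mu i = mu' i" for i
  proof (cases "i \<in> {1..n}")
    case True
    then have "j \<le> mu i \<longleftrightarrow> j \<le> mu' i" if "j \<in> {1..lam i}" for j
      using A.extend_filling_less_iff(1)[OF T S[of i j]] B.extend_filling_less_iff(1)[OF T' S[of i j]] eq that by simp
    then show ?thesis
      using A.mu_le_lam[OF True] B.mu_le_lam[OF True] by (rule initial_segment_eq)
  next
    case False
    then show ?thesis using interlacingD(2)[OF A.mu] interlacingD(2)[OF B.mu] by simp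
  qed
  then have mu: "mu = mu'" by auto
  have "kap i = kap' i" for i
  proof (cases "i \<in> {1..n}")
    case True
    then have "j \<le> kap i \<longleftrightarrow> j \<le> kap' i" if "j \<in> {1..lam i}" for j
      using A.extend_filling_less_iff(2)[OF T S[of i j]] B.extend_filling_less_iff(2)[OF T' S[of i j]] eq that by simp
    then show ?thesis
      using A.kap_bounds(2)[OF True] B.kap_bounds(2)[OF True] by (rule initial_segment_eq)
  next
    case False
    then show ?thesis using inner_stripsD(2)[OF A.kap] inner_stripsD(2)[OF B.kap] by simp
  qed
  then have kap: "kap = kap'" by auto
  have "j \<le> k \<longleftrightarrow> j \<le> k'" if "j \<in> {1..lam (Suc n)}" for j
    using A.extend_filling_less_iff(2)[OF T S[of "Suc n" j]] B.extend_filling_less_iff(2)[OF T' S[of "Suc n" j]] eq that by simp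
  then have k: "k = k'"
    using A.k_le B.k_le by (rule initial_segment_eq)
  have "T p = T' p" for p
  proof (cases "p \<in> shape n mu")
    case True
    obtain i j where p: "p = (i, j)" by (cases p)
    then have "i \<le> n" "j \<le> mu i" using True by (auto simp: shape_iff)
    moreover have "(i, j) \<in> shape (Suc n) lam" using A.shape_mono[OF True] p by simp
    ultimately show ?thesis
      using A.extend_filling_simps(1)[of i j T] B.extend_filling_simps(1)[of i j T'] eq mu p by simp
  next
    case False
    then show ?thesis using eod_fillingsD(2)[OF T] eod_fillingsD(2)[OF T'] mu by simp
  qed
  with mu kap k show ?thesis by auto
qed

text \<open>The index set is that of the branching of the numerator, except that the range of the
  last entry of \<open>kap\<close> is replaced by the two admissible values of
  \<open>k\<close>.\<close>

lemma sum_eod_fillings_Suc: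
  fixes G :: "(nat \<times> nat \<Rightarrow> letter) \<Rightarrow> 'a::comm_monoid_add"
  assumes lam_pos: "\<And>j. j \<in> {1..Suc n} \<Longrightarrow> 1 \<le> lam j"
    and lam_dec: "\<And>j. j \<in> {1..n} \<Longrightarrow> lam (Suc j) \<le> lam j"
  shows "(\<Sum>T\<in>eod_fillings (Suc n) lam. G T) =
    (\<Sum>kap\<in>inner_strips n lam. \<Sum>mu\<in>interlacing n kap. \<Sum>k\<in>{0, last_row_bound n lam mu}.
      \<Sum>T\<in>eod_fillings n mu. G (extend_filling n lam kap mu k T))"
proof -
  let ?X = "SIGMA kap:inner_strips n lam. SIGMA mu:interlacing n kap.
    SIGMA k:{0, last_row_bound n lam mu}. eod_fillings n mu"
  let ?e = "\<lambda>(kap, mu, k, T). extend_filling n lam kap mu k T"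
  have sd: "strip_data n lam kap mu k" if "(kap, mu, k, T) \<in> ?X" for kap mu k T
    by unfold_locales (use that lam_pos lam_dec in auto)
  have "inj_on ?e ?X"
  proof (rule inj_onI)
    fix u v assume uv: "u \<in> ?X" "v \<in> ?X" "?e u = ?e v"
    obtain kap mu k T where u: "u = (kap, mu, k, T)" by (cases u)
    obtain kap' mu' k' T' where v: "v = (kap', mu', k', T')" by (cases v)
    have "kap = kap' \<and> mu = mu' \<and> k = k' \<and> T = T'"
      by (rule extend_filling_inj[OF sd sd]) (use uv u v in auto)
    then show "u = v" by (simp add: u v)
  qed
  moreover have "?e ` ?X = eod_fillings (Suc n) lam"
  proof (intro equalityI subsetI)
    fix T assume "T \<in> ?e ` ?X"
    then obtain kap mu k T' where X: "(kap, mu, k, T') \<in> ?X" and T: "T = extend_filling n lam kap mu k T'" by auto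
    interpret strip_data n lam kap mu k by (rule sd[OF X])
    show "T \<in> eod_fillings (Suc n) lam" unfolding T by (rule extend_filling_in) (use X in auto)
  next
    fix T assume "T \<in> eod_fillings (Suc n) lam"
    from extend_filling_surj[OF lam_pos lam_dec this] obtain kap mu k T' where
      "kap \<in> inner_strips n lam" "mu \<in> interlacing n kap"
      "k \<in> {0, last_row_bound n lam mu}" "T' \<in> eod_fillings n mu" "T = extend_filling n lam kap mu k T'" by metis
    then show "T \<in> ?e ` ?X"
      by (intro image_eqI[of _ _ "(kap, mu, k, T')"]) auto
  qed
  ultimately have "(\<Sum>T\<in>eod_fillings (Suc n) lam. G T) = (\<Sum>u\<in>?X. G (?e u))"
    using sum.reindex[of ?e ?X G] by (simp add: comp_def)
  also have "\<dots> = (\<Sum>(kap, mu, k, T)\<in>?X. G (extend_filling n lam kap mu k T))"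
    by (rule sum.cong) auto
  finally show ?thesis by (simp add: sum.Sigma)
qed

subsection \<open>Weights and signs\<close>

definition filling_bars :: "nat \<Rightarrow> (nat \<times> nat \<Rightarrow> letter) \<Rightarrow> nat" where
  "filling_bars n T = card {i \<in> {1..n}. \<exists>k. T (i, 1) = Barred k}"

definition filling_weight ::
  "nat \<Rightarrow> (nat \<Rightarrow> 'a::field) \<Rightarrow> (nat \<Rightarrow> 'a) \<Rightarrow> (int \<Rightarrow> 'a) \<Rightarrow> (nat \<Rightarrow> nat) \<Rightarrow> (nat \<times> nat \<Rightarrow> letter) \<Rightarrow> 'a" where
  "filling_weight n x xb a mu T = (\<Prod>(i, j)\<in>shape n mu. wgt n x xb a i j (T (i, j)))"

lemma filling_weight_rows:
  "filling_weight n x xb a mu T = (\<Prod>i\<in>{1..n}. \<Prod>j\<in>{1..mu i}. wgt n x xb a i j (T (i, j)))"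
  unfolding filling_weight_def shape_def by (subst prod.Sigma) auto

lemma prod_split_segment:
  fixes f :: "nat \<Rightarrow> 'a::comm_monoid_mult"
  assumes "m \<le> l"
  shows "prod f {1..l} = prod f {1..m} * prod f {m<..l}"
proof -
  have "prod f {1..l} = prod f ({1..m} \<union> {m<..l})"
    by (rule arg_cong[where f = "prod f"]) (use assms in auto)
  also have "\<dots> = prod f {1..m} * prod f {m<..l}"
    by (rule prod.union_disjoint) auto
  finally show ?thesis .
qed

context strip_data
begin

text \<open>An old letter keeps its weight when \<open>Suc n\<close> is replaced by
  \<open>n\<close>, because the change in the index is offset by the shift to
  \<open>a (m - 1)\<close>. For a new letter in row \<open>i \<le> n\<close> and column
  \<open>j\<close> the index is \<open>j + (Suc n - i)\<close>, less 1 if it is unbarred; these are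
  the coefficients of the two strips.\<close>

lemma filling_weight_extend:
  assumes T: "T \<in> eod_fillings n mu"
  shows "filling_weight (Suc n) x xb a lam (extend_filling n lam kap mu k T) =
    (\<Prod>j\<in>{1..n}. \<Prod>r\<in>{kap j<..lam j}. xb (Suc n) + a (int (r + (Suc n - j)))) *
    (\<Prod>j\<in>{1..n}. \<Prod>r\<in>{mu j<..kap j}. x (Suc n) + a (int (r + (Suc n - j)) - 1)) *
    (factorial_power a (x (Suc n)) k * (\<Prod>r\<in>{k<..lam (Suc n)}. xb (Suc n) + a (int r))) *
    filling_weight n x xb (\<lambda>m. a (m - 1)) mu T"
proof -
  let ?N = "Suc n"
  let ?w = "\<lambda>i j. wgt ?N x xb a i j (extend_filling n lam kap mu k T (i, j))"
  have row: "(\<Prod>j\<in>{1..lam i}. ?w i j) =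
    (\<Prod>j\<in>{1..mu i}. wgt n x xb (\<lambda>m. a (m - 1)) i j (T (i, j))) *
    (\<Prod>r\<in>{mu i<..kap i}. x ?N + a (int (r + (?N - i)) - 1)) *
    (\<Prod>r\<in>{kap i<..lam i}. xb ?N + a (int (r + (?N - i))))" if i: "i \<in> {1..n}" for i
  proof -
    have le: "mu i \<le> kap i" "kap i \<le> lam i" using i mu_le kap_bounds(2) by auto
    have S: "(i, j) \<in> shape ?N lam" if "1 \<le> j" "j \<le> lam i" for j
      using i that by (simp add: shape_iff)
    have "(\<Prod>j\<in>{1..mu i}. ?w i j) = (\<Prod>j\<in>{1..mu i}. wgt n x xb (\<lambda>m. a (m - 1)) i j (T (i, j)))"
    proof (rule prod.cong[OF refl])
      fix j assume "j \<in> {1..mu i}"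
      then have "extend_filling n lam kap mu k T (i, j) = T (i, j)"
        using extend_filling_simps(1)[OF S] i le by auto
      then show "?w i j = wgt n x xb (\<lambda>m. a (m - 1)) i j (T (i, j))"
        by (auto simp: wgt_def algebra_simps split: letter.splits)
    qed
    moreover have "(\<Prod>j\<in>{mu i<..kap i}. ?w i j) = (\<Prod>r\<in>{mu i<..kap i}. x ?N + a (int (r + (?N - i)) - 1))"
    proof (rule prod.cong[OF refl])
      fix j assume "j \<in> {mu i<..kap i}"
      then have "extend_filling n lam kap mu k T (i, j) = Unbarred ?N"
        using extend_filling_simps(2)[OF S] i le by auto
      then show "?w i j = x ?N + a (int (j + (?N - i)) - 1)"
        using i by (auto simp: wgt_def of_nat_diff algebra_simps)
    qed
    moreover have "(\<Prod>j\<in>{kap i<..lam i}. ?w i j) = (\<Prod>r\<in>{kap i<..lam i}. xb ?N + a (int (r + (?N - i))))"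
    proof (rule prod.cong[OF refl])
      fix j assume "j \<in> {kap i<..lam i}"
      then have "extend_filling n lam kap mu k T (i, j) = Barred ?N"
        using extend_filling_simps(3)[OF S] i le by auto
      then show "?w i j = xb ?N + a (int (j + (?N - i)))"
        using i by (auto simp: wgt_def of_nat_diff algebra_simps)
    qed
    ultimately show ?thesis
      by (simp only: prod_split_segment[OF le(2)] prod_split_segment[OF le(1)])
  qed
  have last: "(\<Prod>j\<in>{1..lam ?N}. ?w ?N j) =
    factorial_power a (x ?N) k * (\<Prod>r\<in>{k<..lam ?N}. xb ?N + a (int r))"
  proof -
    have S: "(?N, j) \<in> shape ?N lam" if "1 \<le> j" "j \<le> lam ?N" for j
      using that by (simp add: shape_iff)
    have "(\<Prod>j\<in>{1..k}. ?w ?N j) = factorial_power a (x ?N) k"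
      unfolding factorial_power_def
    proof (rule prod.cong[OF refl])
      fix j assume "j \<in> {1..k}"
      then have "extend_filling n lam kap mu k T (?N, j) = Unbarred ?N"
        using extend_filling_simps(4)[OF S] k_le by auto
      \<comment> \<open>In the last row the correction for \<open>i = k\<close> in the weight raises
        the index to \<open>j\<close>, so the unbarred letters form a factorial power.\<close>
      then show "?w ?N j = x ?N + a (int j)" by (simp add: wgt_def)
    qed
    moreover have "(\<Prod>j\<in>{k<..lam ?N}. ?w ?N j) = (\<Prod>r\<in>{k<..lam ?N}. xb ?N + a (int r))"
    proof (rule prod.cong[OF refl])
      fix j assume "j \<in> {k<..lam ?N}"
      then have "extend_filling n lam kap mu k T (?N, j) = Barred ?N"
        using extend_filling_simps(5)[OF S] by auto
      then show "?w ?N j = xb ?N + a (int j)" by (simp add: wgt_def)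
    qed
    ultimately show ?thesis by (simp only: prod_split_segment[OF k_le])
  qed
  have "filling_weight ?N x xb a lam (extend_filling n lam kap mu k T) =
      (\<Prod>i\<in>{1..n}. \<Prod>j\<in>{1..lam i}. ?w i j) * (\<Prod>j\<in>{1..lam ?N}. ?w ?N j)"
    unfolding filling_weight_rows by simp
  also have "(\<Prod>i\<in>{1..n}. \<Prod>j\<in>{1..lam i}. ?w i j) = (\<Prod>i\<in>{1..n}.
    (\<Prod>j\<in>{1..mu i}. wgt n x xb (\<lambda>m. a (m - 1)) i j (T (i, j))) *
    (\<Prod>r\<in>{mu i<..kap i}. x ?N + a (int (r + (?N - i)) - 1)) *
    (\<Prod>r\<in>{kap i<..lam i}. xb ?N + a (int (r + (?N - i)))))"
    by (rule prod.cong[OF refl row])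
  finally show ?thesis
    unfolding last filling_weight_rows prod.distrib by (simp only: mult_ac)
qed

text \<open>In the rows above the last the first cell is old, as \<open>mu\<close> is positive
  there; only row \<open>Suc n\<close> can add a bar, and it does so when no unbarred letter occurs
  in it.\<close>

lemma filling_bars_extend:
  "filling_bars (Suc n) (extend_filling n lam kap mu k T) = filling_bars n T + (if k = 0 then 1 else 0)"
proof -
  let ?E = "extend_filling n lam kap mu k T"
  have S: "(i, 1) \<in> shape (Suc n) lam" if "i \<in> {1..Suc n}" for i
    using that lam_pos[OF that] by (simp add: shape_iff)
  have old: "?E (i, 1) = T (i, 1)" if "i \<in> {1..n}" for i
    by (rule extend_filling_simps(1)[OF S]) (use mu_pos[OF that] that in auto)
  have new: "?E (Suc n, 1) = (if k = 0 then Barred (Suc n) else Unbarred (Suc n))"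
    using extend_filling_simps(4,5)[OF S[of "Suc n"], of T] by (cases "k = 0") simp_all
  define B where "B i \<longleftrightarrow> (\<exists>l. T (i, 1) = Barred l)" for i
  have "filling_bars (Suc n) ?E = card {i \<in> {1..Suc n}. if i = Suc n then k = 0 else B i}"
    unfolding filling_bars_def
  proof (intro arg_cong[where f = card] Collect_cong conj_cong refl)
    fix i assume i: "i \<in> {1..Suc n}"
    show "(\<exists>l. ?E (i, 1) = Barred l) \<longleftrightarrow> (if i = Suc n then k = 0 else B i)"
    proof (cases "i = Suc n")
      case True
      then show ?thesis unfolding True new by simp
    next
      case False
      then show ?thesis unfolding B_def using old[of i] i by simp
    qed
  qed
  also have "{i \<in> {1..Suc n}. if i = Suc n then k = 0 else B i} =
    {i \<in> {1..n}. B i} \<union> (if k = 0 then {Suc n} else {})"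
    by (auto simp: le_Suc_eq)
  also have "card \<dots> = card {i \<in> {1..n}. B i} + (if k = 0 then 1 else 0)"
    by (cases "k = 0") simp_all
  finally show ?thesis unfolding filling_bars_def B_def .
qed

end

text \<open>The right side is that of \<open>last_row_telescope\<close>, so the signed choice
  between two fillings of the last row replaces the telescoping sum. \<open>1 \<le> M\<close> keeps
  the two choices distinct, and for \<open>k = 0\<close> the first \<open>M\<close> barred factors
  form the second factorial power.\<close>

lemma last_row_choices:
  fixes y yb :: "'a::comm_ring_1"
  assumes "1 \<le> M" and "M \<le> l"
  shows "(\<Sum>k\<in>{0, M}. (- 1) ^ (if k = 0 then 1 else 0) *
      (factorial_power a y k * (\<Prod>r\<in>{k<..l}. yb + a (int r)))) =
    (factorial_power a y M - factorial_power a yb M) * (\<Prod>r\<in>{M<..l}. yb + a (int r))"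
proof -
  have "{0<..l} = {1..l}" by auto
  then have "(\<Prod>r\<in>{0<..l}. yb + a (int r)) =
      factorial_power a yb M * (\<Prod>r\<in>{M<..l}. yb + a (int r))"
    using prod_split_segment[OF assms(2)] by (simp add: factorial_power_def)
  then show ?thesis using assms(1) by (simp add: algebra_simps)
qed

text \<open>Induction on the number of variables. The alternant and the fillings branch over the
  same \<open>kap\<close> and \<open>mu\<close> with the same strip weights, and the contributions
  of the last row agree by \<open>last_row_choices\<close>. The parameters are generalised because
  each step shifts them.\<close>

lemma alternant_difference_power:
  fixes x xb :: "nat \<Rightarrow> 'a::field"
  assumes inv: "\<And>k. k \<in> {1..n} \<Longrightarrow> x k * xb k = 1" and a0: "\<And>m. m \<le> 0 \<Longrightarrow> a m = 0"
    and pos: "\<And>j. j \<in> {1..n} \<Longrightarrow> 1 \<le> lam j"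
    and dec: "\<And>j. j \<in> {1..n} \<Longrightarrow> Suc j \<in> {1..n} \<Longrightarrow> lam (Suc j) \<le> lam j"
  shows "alternant n (difference_power x xb a) lam = pair_product n (\<lambda>k. x k + xb k) *
    (\<Sum>T\<in>eod_fillings n lam. (- 1) ^ filling_bars n T * filling_weight n x xb a lam T)"
  using assms
proof (induction n arbitrary: a lam)
  case 0
  \<comment> \<open>The empty shape carries exactly one filling, of weight 1, and the empty
    alternant is 1 as well.\<close>
  have "eod_fillings 0 lam = {\<lambda>_. undefined}"
    by (auto simp: eod_fillings_def shape_def)
  then show ?case
    by (simp add: alternant_def pair_product_def filling_bars_def filling_weight_def shape_def)
next
  case (Suc n)
  let ?N = "Suc n"
  let ?b = "\<lambda>kap. \<Prod>j\<in>{1..n}. \<Prod>r\<in>{kap j<..lam j}. xb ?N + a (int (r + (?N - j)))"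
  let ?c = "\<lambda>kap mu. \<Prod>j\<in>{1..n}. \<Prod>r\<in>{mu j<..kap j}. x ?N + a (int (r + (?N - j)) - 1)"
  let ?d = "\<lambda>k. factorial_power a (x ?N) k * (\<Prod>r\<in>{k<..lam ?N}. xb ?N + a (int r))"
  let ?a = "\<lambda>m. a (m - 1)"
  let ?F = "\<lambda>mu. \<Sum>T\<in>eod_fillings n mu. (- 1) ^ filling_bars n T * filling_weight n x xb ?a mu T"
  let ?M = "last_row_bound n lam"
  let ?D = "\<lambda>mu. (factorial_power a (x ?N) (?M mu) - factorial_power a (xb ?N) (?M mu)) *
       (\<Prod>r\<in>{?M mu<..lam ?N}. xb ?N + a (int r))"
  let ?P = "pair_product n (\<lambda>k. x k + xb k)"
  have pos: "1 \<le> lam j" if "j \<in> {1..?N}" for j using Suc.prems(3)[OF that] .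
  have dec: "lam (Suc j) \<le> lam j" if "j \<in> {1..n}" for j using Suc.prems(4)[of j] that by auto
  have sd: "strip_data n lam kap mu k" if "kap \<in> inner_strips n lam" "mu \<in> interlacing n kap"
    "k \<in> {0, ?M mu}" for kap mu k
    by unfold_locales (use that pos dec in auto)
  have alt: "alternant n (difference_power x xb ?a) mu = ?P * ?F mu"
    if "kap \<in> inner_strips n lam" "mu \<in> interlacing n kap" for kap mu
  proof (rule Suc.IH)
    interpret strip_data n lam kap mu 0 by (rule sd) (use that in auto)
    show "1 \<le> mu j" if "j \<in> {1..n}" for j using mu_pos[OF that] .
    show "mu (Suc j) \<le> mu j" if "j \<in> {1..n}" "Suc j \<in> {1..n}" for j using mu_dec[OF that] .
  qed (use Suc.prems in auto)
  have pull: "(\<Sum>k\<in>A. u * f k * v) = u * (\<Sum>k\<in>A. f k) * v" for A :: "nat set" and f u and v :: 'a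
    by (simp add: sum_distrib_left sum_distrib_right)
  have fill: "(\<Sum>k\<in>{0, ?M mu}. \<Sum>T\<in>eod_fillings n mu.
      (- 1) ^ filling_bars ?N (extend_filling n lam kap mu k T) *
      filling_weight ?N x xb a lam (extend_filling n lam kap mu k T)) = ?b kap * ?c kap mu * ?D mu * ?F mu"
    if km: "kap \<in> inner_strips n lam" "mu \<in> interlacing n kap" for kap mu
  proof -
    have "(\<Sum>T\<in>eod_fillings n mu. (- 1) ^ filling_bars ?N (extend_filling n lam kap mu k T) *
      filling_weight ?N x xb a lam (extend_filling n lam kap mu k T)) =
      ?b kap * ?c kap mu * ((- 1) ^ (if k = 0 then 1 else 0) * ?d k) * ?F mu" if k: "k \<in> {0, ?M mu}" for k
    proof -
      interpret strip_data n lam kap mu k by (rule sd[OF km k])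
      have "(\<Sum>T\<in>eod_fillings n mu. (- 1) ^ filling_bars ?N (extend_filling n lam kap mu k T) *
        filling_weight ?N x xb a lam (extend_filling n lam kap mu k T)) =
        (\<Sum>T\<in>eod_fillings n mu. ?b kap * ?c kap mu * ((- 1) ^ (if k = 0 then 1 else 0) * ?d k) *
          ((- 1) ^ filling_bars n T * filling_weight n x xb ?a mu T))"
        by (rule sum.cong[OF refl])
          (simp only: filling_bars_extend filling_weight_extend power_add mult_ac)
      then show ?thesis by (simp only: sum_distrib_left)
    qed
    then have "(\<Sum>k\<in>{0, ?M mu}. \<Sum>T\<in>eod_fillings n mu.
      (- 1) ^ filling_bars ?N (extend_filling n lam kap mu k T) *
      filling_weight ?N x xb a lam (extend_filling n lam kap mu k T)) =
      (\<Sum>k\<in>{0, ?M mu}. ?b kap * ?c kap mu * ((- 1) ^ (if k = 0 then 1 else 0) * ?d k) * ?F mu)"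
      by (rule sum.cong[OF refl])
    also have "\<dots> = ?b kap * ?c kap mu * (\<Sum>k\<in>{0, ?M mu}. (- 1) ^ (if k = 0 then 1 else 0) * ?d k) * ?F mu"
      by (rule pull)
    also have "(\<Sum>k\<in>{0, ?M mu}. (- 1) ^ (if k = 0 then 1 else 0) * ?d k) = ?D mu"
    proof (rule last_row_choices)
      interpret strip_data n lam kap mu 0 by (rule sd) (use km in auto)
      show "1 \<le> ?M mu" using pos[of ?N] mu_pos[of n] by (auto simp: last_row_bound_def)
      show "?M mu \<le> lam ?N" by (auto simp: last_row_bound_def)
    qed
    finally show ?thesis .
  qed
  have "alternant ?N (difference_power x xb a) lam =
    (\<Prod>i<n. (x (Suc i) + xb (Suc i)) - (x ?N + xb ?N)) *
    (\<Sum>kap\<in>inner_strips n lam. \<Sum>mu\<in>interlacing n kap.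
      ?b kap * ?c kap mu * ?D mu * alternant n (difference_power x xb ?a) mu)"
    by (rule alternant_difference_branching) (use Suc.prems pos dec in auto)
  also have "\<dots> = (\<Prod>i<n. (x (Suc i) + xb (Suc i)) - (x ?N + xb ?N)) *
    (\<Sum>kap\<in>inner_strips n lam. \<Sum>mu\<in>interlacing n kap.
      ?P * (?b kap * ?c kap mu * ?D mu * ?F mu))"
  proof (rule arg_cong2[where f = "(*)"], rule refl, intro sum.cong refl)
    fix kap mu assume "kap \<in> inner_strips n lam" "mu \<in> interlacing n kap"
    then show "?b kap * ?c kap mu * ?D mu * alternant n (difference_power x xb ?a) mu =
      ?P * (?b kap * ?c kap mu * ?D mu * ?F mu)"
      by (simp only: alt mult_ac)
  qed
  also have "\<dots> = pair_product ?N (\<lambda>k. x k + xb k) *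
    (\<Sum>kap\<in>inner_strips n lam. \<Sum>mu\<in>interlacing n kap. ?b kap * ?c kap mu * ?D mu * ?F mu)"
    by (simp add: pair_product_def sum_distrib_left mult_ac)
  also have "(\<Sum>kap\<in>inner_strips n lam. \<Sum>mu\<in>interlacing n kap. ?b kap * ?c kap mu * ?D mu * ?F mu) =
    (\<Sum>T\<in>eod_fillings ?N lam. (- 1) ^ filling_bars ?N T * filling_weight ?N x xb a lam T)"
  proof -
    have "(\<Sum>T\<in>eod_fillings ?N lam. (- 1) ^ filling_bars ?N T * filling_weight ?N x xb a lam T) =
      (\<Sum>kap\<in>inner_strips n lam. \<Sum>mu\<in>interlacing n kap. \<Sum>k\<in>{0, ?M mu}. \<Sum>T\<in>eod_fillings n mu.
        (- 1) ^ filling_bars ?N (extend_filling n lam kap mu k T) *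
        filling_weight ?N x xb a lam (extend_filling n lam kap mu k T))"
      by (rule sum_eod_fillings_Suc) (use pos dec in auto)
    also have "\<dots> = (\<Sum>kap\<in>inner_strips n lam. \<Sum>mu\<in>interlacing n kap. ?b kap * ?c kap mu * ?D mu * ?F mu)"
      by (intro sum.cong refl fill)
    finally show ?thesis ..
  qed
  finally show ?case .
qed

section \<open>Passage to the tableaux of the theorem\<close>

lemma young_diagram_eq_shape: "young_diagram lam = shape (length lam) (part_at lam)"
  by (auto simp: young_diagram_def shape_def)

lemma tableaux_eod_eq: "tableaux_eod n lam = eod_fillings n (part_at lam)" if "length lam = n"
proof -
  have cols: "(\<forall>i i' j. (i, j) \<in> S \<and> (i', j) \<in> S \<and> i \<le> i' \<longrightarrow> T (i, j) \<le> T (i', j)) \<and>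
     (\<forall>i i' j. (i, j) \<in> S \<and> (i', j) \<in> S \<and> i \<noteq> i' \<longrightarrow> T (i, j) \<noteq> T (i', j)) \<longleftrightarrow>
     (\<forall>i i' j. (i, j) \<in> S \<and> (i', j) \<in> S \<and> i < i' \<longrightarrow> T (i, j) < T (i', j))"
    (is "?weak \<and> ?distinct \<longleftrightarrow> ?strict")
    for S :: "(nat \<times> nat) set" and T :: "nat \<times> nat \<Rightarrow> letter"
  proof
    assume "?weak \<and> ?distinct"
    then show ?strict by (metis less_imp_le less_imp_neq order_le_neq_trans)
  next
    assume s: ?strict
    have ?weak using s by (metis le_less)
    moreover have ?distinct using s by (metis linorder_neqE_nat less_irrefl)
    ultimately show "?weak \<and> ?distinct" ..
  qed
  have orth: "(\<forall>k. (\<exists>j. (k, j) \<in> S \<and> T (k, j) = Unbarred k)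
        \<longrightarrow> (\<forall>j. (k, j) \<in> S \<and> T (k, j) = Barred k \<longrightarrow> (k - 1, j) \<in> S \<and> T (k - 1, j) = Unbarred k)) \<longleftrightarrow>
     (\<forall>k j j'. (k, j) \<in> S \<and> (k, j') \<in> S \<and> T (k, j) = Unbarred k \<and> T (k, j') = Barred k
        \<longrightarrow> (k - 1, j') \<in> S \<and> T (k - 1, j') = Unbarred k)"
    for S :: "(nat \<times> nat) set" and T :: "nat \<times> nat \<Rightarrow> letter"
    by blast
  show ?thesis
    unfolding tableaux_eod_def tableaux_eo_def eod_fillings_def young_diagram_eq_shape that
      orth cols[symmetric]
    by (simp only: mem_Collect_eq conj_assoc)
qed

text \<open>All rows of a partition are nonempty, so the cells \<open>(i, 1)\<close> of the diagram
  are exactly those with \<open>i\<close> in \<open>{1..n}\<close>.\<close>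

lemma bar_count_eq: "bar_count lam T = filling_bars n T" if "length lam = n" "is_partition lam"
proof -
  have "1 \<le> part_at lam i" if "i \<in> {1..n}" for i
    using that \<open>length lam = n\<close> \<open>is_partition lam\<close>
    by (auto simp: part_at_def is_partition_def Suc_le_eq)
  then show ?thesis
    unfolding bar_count_def filling_bars_def young_diagram_eq_shape that(1)
    by (intro arg_cong[where f = card]) (auto simp: shape_iff)
qed

lemma pair_product_nonzero:
  fixes c :: "nat \<Rightarrow> 'a::idom"
  assumes "\<And>i j. i \<in> {1..n} \<Longrightarrow> j \<in> {1..n} \<Longrightarrow> i \<noteq> j \<Longrightarrow> c i \<noteq> c j"
  shows "pair_product n c \<noteq> 0"
  using assms by (auto simp: pair_product_def)

text \<open>Only the column of exponent 0 differs from \<open>sum_power\<close>: its entries are 2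
  instead of 1. The factor is taken out after transposing, because \<open>det_scale_rows\<close>
  acts on rows; it later cancels the 1/2 in the character.\<close>

lemma det_sum_eq_alternant:
  fixes x xb :: "nat \<Rightarrow> 'a::comm_ring_1"
  assumes "1 \<le> n"
  shows "det (mat n n (\<lambda>(i, j). factorial_power a (x (Suc i)) (n - Suc j) + factorial_power a (xb (Suc i)) (n - Suc j)))
    = 2 * alternant n (sum_power x xb a) (\<lambda>_. 1)"
proof -
  let ?s = "\<lambda>i j. sum_power x xb a (1 + (n - Suc j)) i"
  let ?d = "\<lambda>j. if Suc j = n then 2 else 1 :: 'a"
  have "mat n n (\<lambda>(i, j). factorial_power a (x (Suc i)) (n - Suc j) + factorial_power a (xb (Suc i)) (n - Suc j))
    = transpose_mat (mat n n (\<lambda>(j, i). ?d j * ?s i j))"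
    by (rule eq_matI) (auto simp: sum_power_def)
  also have "det \<dots> = det (mat n n (\<lambda>(j, i). ?d j * ?s i j))"
    by (rule det_transpose[of _ n]) simp
  also have "\<dots> = (\<Prod>j<n. ?d j) * det (mat n n (\<lambda>(j, i). ?s i j))"
    by (rule det_scale_rows)
  also have "(\<Prod>j<n. ?d j) = (\<Prod>j<n. if j = n - 1 then 2 else 1)"
    using assms by (intro prod.cong) auto
  also have "\<dots> = 2"
    using assms by (simp add: prod.delta)
  also have "det (mat n n (\<lambda>(j, i). ?s i j)) = det (transpose_mat (mat n n (\<lambda>(j, i). ?s i j)))"
    by (rule det_transpose[of _ n, symmetric]) simp
  also have "transpose_mat (mat n n (\<lambda>(j, i). ?s i j)) = mat n n (\<lambda>(i, j). ?s i j)"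
    by (rule eq_matI) auto
  finally show ?thesis by (simp add: alternant_def)
qed

theorem theorem3:
  fixes n :: nat
    and x xb :: "nat \<Rightarrow> 'a::field_char_0"
    and a :: "int \<Rightarrow> 'a"
    and lam :: "nat list"
  assumes "1 \<le> n"
    and "\<And>k. k \<in> {1..n} \<Longrightarrow> x k \<noteq> 0"
    and "\<And>k. k \<in> {1..n} \<Longrightarrow> xb k = inverse (x k)"
    and "\<And>i j. i \<in> {1..n} \<Longrightarrow> j \<in> {1..n} \<Longrightarrow> i \<noteq> j \<Longrightarrow> x i \<noteq> x j \<and> x i * x j \<noteq> 1"
    and "\<And>m. m \<le> 0 \<Longrightarrow> a m = 0"
    and "is_partition lam"
    and "length lam = n"
  shows "factorial_difference_character n lam x xb a =
    (\<Sum>T \<in> tableaux_eod n lam.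
      (-1) ^ bar_count lam T * (\<Prod>(i, j) \<in> young_diagram lam. wgt n x xb a i j (T (i, j))))"
proof -
  let ?c = "\<lambda>k. x k + xb k"
  let ?lam = "part_at lam"
  let ?S = "\<Sum>T\<in>eod_fillings n ?lam. (- 1) ^ filling_bars n T * filling_weight n x xb a ?lam T"
  have inv: "x k * xb k = 1" if "k \<in> {1..n}" for k using assms(2,3) that by simp
  have pos: "1 \<le> ?lam j" if "j \<in> {1..n}" for j
    using assms(6,7) that by (auto simp: part_at_def is_partition_def Suc_le_eq)
  have dec: "?lam (Suc j) \<le> ?lam j" if "j \<in> {1..n}" "Suc j \<in> {1..n}" for j
    using assms(6,7) that by (auto simp: part_at_def is_partition_def sorted_wrt_iff_nth_less)
  have nonzero: "pair_product n ?c \<noteq> 0"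
  proof (rule pair_product_nonzero)
    fix i j assume ij: "i \<in> {1..n}" "j \<in> {1..n}" "i \<noteq> j"
    show "?c i \<noteq> ?c j"
    proof
      assume eq: "?c i = ?c j"
      \<comment> \<open>The difference of the two sums, multiplied by \<open>x i * x j\<close>,
        factorises. Neither factor vanishes, because \<open>x i\<close> and \<open>x j\<close> are
        distinct and not inverse to each other.\<close>
      have "(x i - x j) * (x i * x j - 1) = x i * x j * (x i + xb i) - x i * x j * (x j + xb j)"
        using inv[OF ij(1)] inv[OF ij(2)]
        by (simp add: algebra_simps)
      also have "\<dots> = 0" using eq by simp
      finally show False using assms(4)[OF ij] by auto
    qed
  qed
  have numerator: "det (mat n n (\<lambda>(i, j).
         factorial_power a (x (Suc i)) (?lam (Suc j) + n - Suc j)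
       - factorial_power a (xb (Suc i)) (?lam (Suc j) + n - Suc j))) = alternant n (difference_power x xb a) ?lam"
    unfolding alternant_def
    by (rule arg_cong[where f = det], rule cong_mat) (auto simp: difference_power_def)
  have "factorial_difference_character n lam x xb a =
    alternant n (difference_power x xb a) ?lam / alternant n (sum_power x xb a) (\<lambda>_. 1)"
    unfolding factorial_difference_character_def numerator det_sum_eq_alternant[OF assms(1)] by simp
  also have "\<dots> = ?S"
  proof -
    have "alternant n (difference_power x xb a) ?lam = pair_product n ?c * ?S"
      by (rule alternant_difference_power) (use inv assms(5) pos dec in auto)
    moreover have "alternant n (sum_power x xb a) (\<lambda>_. 1) = pair_product n ?c"
      by (rule alternant_sum_power) (use inv assms(5) in auto)
    ultimately show ?thesis using nonzero by simp
  qed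
  also have "\<dots> = (\<Sum>T \<in> tableaux_eod n lam.
      (-1) ^ bar_count lam T * (\<Prod>(i, j) \<in> young_diagram lam. wgt n x xb a i j (T (i, j))))"
    unfolding tableaux_eod_eq[OF assms(7)] bar_count_eq[OF assms(7,6)] filling_weight_def
      young_diagram_eq_shape assms(7) ..
  finally show ?thesis .
qed

end
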